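(* Let $\mathbb{G}$ be a Carnot group (of arbitrary step) with homogeneous dimension $Q\ge 3$, and let $N=u^{1/(2-Q)}$ be the homogeneous norm associated with the fundamental solution $u$ for the sub-Laplacian $\Delta_{\mathbb{G}}$. Let $\alpha\in\mathbb{R}$ with $Q+\alpha-2>0$. Then for every (real-valued) $\phi\in C_0^\infty(\mathbb{G}\setminus\{0\})$, $$\int_{\mathbb{G}} N^{\alpha}|\nabla_{\mathbb{G}}\phi|^2\,dx\ \ge\ \Big(\frac{Q+\alpha-2}{2}\Big)^2\int_{\mathbb{G}} N^{\alpha}\,\frac{|\nabla_{\mathbb{G}}N|^2}{N^2}\,\phi^2\,dx .$$ Furthermore, the constant $C(Q,\alpha)=\big(\frac{Q+\alpha-2}{2}\big)^2$ is sharp, i.e. it cannot be replaced by any larger constant so that the inequality still holds for all such $\phi$.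
   Context: A Carnot group is a connected, simply connected, nilpotent Lie group $\mathbb{G}\equiv(\mathbb{R}^n,\cdot)$ (identified with $\mathbb{R}^n$ via the exponential map, neutral element $0$) whose Lie algebra $\mathcal{G}$ admits a stratification: there are linear subspaces $V_1,\dots,V_k$ with $\mathcal{G}=V_1\oplus\dots\oplus V_k$, $[V_1,V_i]=V_{i+1}$ for $i=1,\dots,k-1$, and $[V_1,V_k]=0$, where $[V_1,V_i]$ is the subspace generated by the elements $[X,Y]$ with $X\in V_1$, $Y\in V_i$; $k\ge1$ is the step. There are group automorphisms (dilations) $\delta_\lambda(x_1,\dots,x_n)=(\lambda^{\alpha_1}x_1,\dots,\lambda^{\alpha_n}x_n)$, $\lambda>0$, with integers $1=\alpha_1=\dots=\alpha_m<\alpha_{m+1}\le\dots\le\alpha_n$, $m=\dim V_1$ (these exponents $\alpha_i$ are unrelated to the real parameter $\alpha$). The homogeneous dimension is $Q=\sum_{j=1}^k j\,\dim V_j$. $X_1,\dots,X_m$ are the left-invariant vector fields forming an orthonormal basis of $V_1\equiv\mathbb{R}^m$ at the origin, $X_j(0)=\partial_{x_j}$. The horizontal gradient is $\nabla_{\mathbb{G}}=(X_1,\dots,X_m)$ with $|\nabla_{\mathbb{G}}f|^2=\sum_{j=1}^m(X_jf)^2$, and the sub-Laplacian is $\Delta_{\mathbb{G}}=\sum_{j=1}^m X_j^2$. A homogeneous norm on $\mathbb{G}$ is a continuous function $N:\mathbb{G}\to[0,\infty)$, smooth away from the origin, with $N(\delta_\lambda(x))=\lambda N(x)$, $N(x^{-1})=N(x)$,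 and $N(x)=0$ iff $x=0$. A fundamental solution $u$ for $\Delta_{\mathbb{G}}$ is a weak solution of $-\Delta_{\mathbb{G}}u=\delta$, where $\delta$ is the Dirac distribution at $0$. By a theorem of Folland there is a homogeneous norm $N$ such that $u=N^{2-Q}$ is a fundamental solution; this is the $u$ and $N$ used here, i.e. $N(x)=u(x)^{1/(2-Q)}$ for $x\ne0$ and $N(0)=0$. $dx$ is Haar measure (Lebesgue measure on $\mathbb{R}^n$), and $C_0^\infty(\mathbb{G}\setminus\{0\})$ is the space of smooth functions with compact support in $\mathbb{G}\setminus\{0\}$. The value of the left-hand integral is allowed to be $+\infty$. *)

theory Defs
  imports "HOL-Analysis.Analysis"
begin

primrec higher_differentiable_on ::
  "'a::real_normed_vector set \<Rightarrow> nat \<Rightarrow> ('a \<Rightarrow> 'b::real_normed_vector) \<Rightarrow> bool" where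
  "higher_differentiable_on S 0 f \<longleftrightarrow> continuous_on S f"
| "higher_differentiable_on S (Suc r) f \<longleftrightarrow>
     (\<forall>x\<in>S. f differentiable (at x)) \<and>
     (\<forall>v. higher_differentiable_on S r (\<lambda>x. frechet_derivative f (at x) v))"

text \<open>Meant for open sets \<open>S\<close> and finite-dimensional domains, where it is the usual
  \<open>C\<close>-infinity regularity.\<close>

definition smooth_on :: "'a::real_normed_vector set \<Rightarrow> ('a \<Rightarrow> 'b::real_normed_vector) \<Rightarrow> bool" where
  "smooth_on S f \<longleftrightarrow> (\<forall>r. higher_differentiable_on S r f)"

text \<open>For open \<open>U\<close>, the space of smooth functions with compact support in \<open>U\<close>; its
  elements are extended by zero to the whole space.\<close>

definition test_functions :: "'a::real_normed_vector set \<Rightarrow> ('a \<Rightarrow> real) set" where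
  "test_functions U =
     {\<phi>. smooth_on UNIV \<phi> \<and> compact (closure {x. \<phi> x \<noteq> 0}) \<and> closure {x. \<phi> x \<noteq> 0} \<subseteq> U}"

text \<open>A Lie group structure on \<open>\<real>\<^sup>n\<close> (hence connected and simply connected) with neutral
  element \<open>0\<close>, in exponential coordinates: the tangent space at \<open>0\<close> is identified with
  \<open>\<real>\<^sup>n\<close>, and the exponential map is the identity, i.e. the one-parameter subgroup with
  initial velocity \<open>x\<close> is \<open>t \<mapsto> t x\<close>. In particular the group inverse of \<open>x\<close> is \<open>- x\<close>.\<close>

definition exponential_lie_group :: "(real^'n \<Rightarrow> real^'n \<Rightarrow> real^'n) \<Rightarrow> bool" where
  "exponential_lie_group mul \<longleftrightarrow>
     group mul 0 uminus \<and>
     smooth_on UNIV (\<lambda>(x, y). mul x y) \<and>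
     (\<forall>x s t. mul (s *\<^sub>R x) (t *\<^sub>R x) = (s + t) *\<^sub>R x)"

text \<open>The left-invariant vector field with value \<open>v\<close> at \<open>0\<close>, as a map into \<open>\<real>\<^sup>n\<close> and as a
  derivation on functions.\<close>

definition left_inv_field :: "(real^'n \<Rightarrow> real^'n \<Rightarrow> real^'n) \<Rightarrow> real^'n \<Rightarrow> real^'n \<Rightarrow> real^'n" where
  "left_inv_field mul v x = frechet_derivative (\<lambda>y. mul x y) (at 0) v"

definition left_inv_deriv ::
  "(real^'n \<Rightarrow> real^'n \<Rightarrow> real^'n) \<Rightarrow> real^'n \<Rightarrow> (real^'n \<Rightarrow> real) \<Rightarrow> real^'n \<Rightarrow> real" where
  "left_inv_deriv mul v f x = frechet_derivative f (at x) (left_inv_field mul v x)"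

text \<open>The commutator \<open>X Y - Y X\<close> of vector fields, in coordinates.\<close>

definition vf_commutator ::
  "(real^'n \<Rightarrow> real^'n) \<Rightarrow> (real^'n \<Rightarrow> real^'n) \<Rightarrow> real^'n \<Rightarrow> real^'n" where
  "vf_commutator X Y x = frechet_derivative Y (at x) (X x) - frechet_derivative X (at x) (Y x)"

text \<open>The Lie algebra is the tangent space \<open>\<real>\<^sup>n\<close> at \<open>0\<close>, a left-invariant field being
  identified with its value at \<open>0\<close>.\<close>

definition lie_bracket :: "(real^'n \<Rightarrow> real^'n \<Rightarrow> real^'n) \<Rightarrow> real^'n \<Rightarrow> real^'n \<Rightarrow> real^'n" where
  "lie_bracket mul v w = vf_commutator (left_inv_field mul v) (left_inv_field mul w) 0"

definition bracket_space ::
  "(real^'n \<Rightarrow> real^'n \<Rightarrow> real^'n) \<Rightarrow> (real^'n) set \<Rightarrow> (real^'n) set \<Rightarrow> (real^'n) set" where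
  "bracket_space mul A B = span {lie_bracket mul v w | v w. v \<in> A \<and> w \<in> B}"

definition stratification ::
  "(real^'n \<Rightarrow> real^'n \<Rightarrow> real^'n) \<Rightarrow> (nat \<Rightarrow> (real^'n) set) \<Rightarrow> nat \<Rightarrow> bool" where
  "stratification mul V k \<longleftrightarrow>
     k \<ge> 1 \<and>
     (\<forall>j\<in>{1..k}. subspace (V j)) \<and>
     (\<forall>x. \<exists>!v. v \<in> (\<Pi>\<^sub>E j\<in>{1..k}. V j) \<and> x = (\<Sum>j\<in>{1..k}. v j)) \<and>
     (\<forall>i. 1 \<le> i \<and> i < k \<longrightarrow> bracket_space mul (V 1) (V i) = V (Suc i)) \<and>
     bracket_space mul (V 1) (V k) = {0}"

definition dilation :: "('n \<Rightarrow> nat) \<Rightarrow> real \<Rightarrow> real^'n \<Rightarrow> real^'n" where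
  "dilation wt r x = (\<chi> i. r ^ wt i * x $ i)"

text \<open>The coordinates carry positive integer weights \<open>wt\<close>, and the coordinates of weight
  \<open>1\<close> are those of the first layer: the coordinate vectors of weight \<open>1\<close> form a basis of
  \<open>V 1\<close>. The index type is unordered, so the weights are not required to be listed in
  nondecreasing order. Nilpotency follows from the stratification.\<close>

definition carnot_group ::
  "(real^'n \<Rightarrow> real^'n \<Rightarrow> real^'n) \<Rightarrow> (nat \<Rightarrow> (real^'n) set) \<Rightarrow> nat \<Rightarrow> ('n \<Rightarrow> nat) \<Rightarrow> bool" where
  "carnot_group mul V k wt \<longleftrightarrow>
     exponential_lie_group mul \<and>
     stratification mul V k \<and>
     (\<forall>i. wt i \<ge> 1) \<and>
     V 1 = span {axis i 1 | i. wt i = 1} \<and>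
     (\<forall>r>0. \<forall>x y. dilation wt r (mul x y) = mul (dilation wt r x) (dilation wt r y))"

definition homogeneous_dimension :: "(nat \<Rightarrow> (real^'n) set) \<Rightarrow> nat \<Rightarrow> nat" where
  "homogeneous_dimension V k = (\<Sum>j=1..k. j * dim (V j))"

text \<open>The field \<open>X\<^sub>j\<close> is the left-invariant one with value \<open>axis j 1\<close> at \<open>0\<close>, for \<open>j\<close> of
  weight \<open>1\<close>; the metric on the first layer makes these orthonormal.\<close>

definition hgrad_sq ::
  "(real^'n \<Rightarrow> real^'n \<Rightarrow> real^'n) \<Rightarrow> ('n \<Rightarrow> nat) \<Rightarrow> (real^'n \<Rightarrow> real) \<Rightarrow> real^'n \<Rightarrow> real" where
  "hgrad_sq mul wt f x = (\<Sum>j | wt j = 1. (left_inv_deriv mul (axis j 1) f x)\<^sup>2)"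

definition sublaplacian ::
  "(real^'n \<Rightarrow> real^'n \<Rightarrow> real^'n) \<Rightarrow> ('n \<Rightarrow> nat) \<Rightarrow> (real^'n \<Rightarrow> real) \<Rightarrow> real^'n \<Rightarrow> real" where
  "sublaplacian mul wt f x =
     (\<Sum>j | wt j = 1. left_inv_deriv mul (axis j 1) (left_inv_deriv mul (axis j 1) f) x)"

definition homogeneous_norm :: "('n \<Rightarrow> nat) \<Rightarrow> (real^'n \<Rightarrow> real) \<Rightarrow> bool" where
  "homogeneous_norm wt N \<longleftrightarrow>
     continuous_on UNIV N \<and>
     smooth_on (UNIV - {0}) N \<and>
     (\<forall>x. N x \<ge> 0) \<and>
     (\<forall>r>0. \<forall>x. N (dilation wt r x) = r * N x) \<and>
     (\<forall>x. N (- x) = N x) \<and>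
     (\<forall>x. N x = 0 \<longleftrightarrow> x = 0)"

text \<open>Minus the sub-Laplacian of \<open>u\<close> is the Dirac distribution at \<open>0\<close>, in the sense of
  distributions. On a Carnot group each \<open>X\<^sub>j\<close> is divergence free, so the sub-Laplacian is
  its own formal adjoint.\<close>

definition fundamental_solution ::
  "(real^'n \<Rightarrow> real^'n \<Rightarrow> real^'n) \<Rightarrow> ('n \<Rightarrow> nat) \<Rightarrow> (real^'n \<Rightarrow> real) \<Rightarrow> bool" where
  "fundamental_solution mul wt u \<longleftrightarrow>
     (\<forall>K. compact K \<longrightarrow> set_integrable lborel K u) \<and>
     (\<forall>\<phi>\<in>test_functions UNIV. (LINT x|lborel. u x * (- sublaplacian mul wt \<phi> x)) = \<phi> 0)"

text \<open>The weighted Hardy inequality with constant \<open>C \<ge> 0\<close>; both integrands are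
  nonnegative and the integrals take values in \<open>[0, \<infinity>]\<close>.\<close>

definition hardy_inequality ::
  "(real^'n \<Rightarrow> real^'n \<Rightarrow> real^'n) \<Rightarrow> ('n \<Rightarrow> nat) \<Rightarrow> (real^'n \<Rightarrow> real) \<Rightarrow> real \<Rightarrow> real
     \<Rightarrow> (real^'n \<Rightarrow> real) \<Rightarrow> bool" where
  "hardy_inequality mul wt N \<alpha> C \<phi> \<longleftrightarrow>
     (\<integral>\<^sup>+x. ennreal (N x powr \<alpha> * hgrad_sq mul wt \<phi> x) \<partial>lborel)
       \<ge> ennreal C *
         (\<integral>\<^sup>+x. ennreal (N x powr \<alpha> * (hgrad_sq mul wt N x / (N x)\<^sup>2) * (\<phi> x)\<^sup>2) \<partial>lborel)"

end

theory Submission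
  imports Defs
begin

text \<open>
  Write \<open>\<gamma> = (Q + \<alpha> - 2) / 2\<close>, \<open>X\<^sub>j\<close> for the left-invariant field with value \<open>axis j 1\<close> at \<open>0\<close>,
  \<open>\<nabla>\<close> for the horizontal gradient and \<open>\<delta>\<^sub>r\<close> for the dilations.

  The inequality. The function \<open>u = N\<^sup>2\<^sup>-\<^sup>Q\<close> is weakly harmonic off \<open>0\<close>, that is, the integral of
  \<open>\<nabla>u \<bullet> \<nabla>\<eta>\<close> vanishes for all test functions \<open>\<eta>\<close> supported off \<open>0\<close> (\<open>weakly_harmonic\<close>). With
  \<open>\<eta> = N powr (2 \<gamma>) * \<phi>\<^sup>2\<close> this says that the integral of \<open>2 N powr (\<alpha> - 1) * \<phi> * (\<nabla>N \<bullet> \<nabla>\<phi>)\<close> equals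
  \<open>- 2 \<gamma>\<close> times the integral of \<open>N powr (\<alpha> - 2) * |\<nabla>N|\<^sup>2 * \<phi>\<^sup>2\<close> (\<open>hardy_identity\<close>). The Hardy inequality
  then is the nonnegativity of the integral of \<open>N powr \<alpha> * |\<nabla>\<phi> + \<gamma> \<phi> \<nabla>N / N|\<^sup>2\<close>, expanded (\<open>hardy\<close>).

  Weak harmonicity requires integration by parts for the \<open>X\<^sub>j\<close>, which must be divergence free. This
  follows from homogeneity: the derivative of the \<open>i\<close>-th component of \<open>X\<^sub>j\<close> along the \<open>i\<close>-th
  coordinate has negative degree under dilations but is continuous at \<open>0\<close>, hence it is zero
  (\<open>left_inv_field_diagonal_derivative\<close>).

  Sharpness. The dilations scale Lebesgue measure by \<open>r powr Q\<close> (\<open>integral_dilation\<close>; the exponent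
  comes from the homogeneity of the fundamental solution). Therefore the measure with density
  \<open>N powr (- Q) * |\<nabla>N|\<^sup>2\<close> is dilation invariant, and its image under \<open>ln N\<close> is a translation invariant
  measure on the line (\<open>annulus_mass_scale\<close>). It is finite on bounded intervals because \<open>N\<close> is proper
  (\<open>compact_N_sublevel\<close>) and not zero because \<open>X\<^sub>j N = N > 0\<close> at the coordinate vector \<open>axis j 1\<close> of
  the first layer (\<open>left_inv_deriv_N_axis\<close>). On trial functions \<open>N powr (- \<gamma>) * bump (ln N / R)\<close> both
  sides of the inequality are integrals against this measure, and their quotient tends to \<open>\<gamma>\<^sup>2\<close> as
  \<open>R\<close> tends to infinity (\<open>sharp\<close>).
\<close>

section \<open>Calculus of smooth functions\<close>

lemma higher_differentiable_on_continuous: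
  "higher_differentiable_on S r f \<Longrightarrow> continuous_on S f"
  by (cases r) (auto intro!: continuous_at_imp_continuous_on differentiable_imp_continuous_within)

lemma higher_differentiable_on_Suc:
  "higher_differentiable_on S (Suc r) f \<Longrightarrow> higher_differentiable_on S r f"
proof (induction r arbitrary: f)
  case 0
  then show ?case by (auto intro: higher_differentiable_on_continuous[where r = 1])
qed auto

lemma higher_differentiable_on_cong:
  assumes "open S" "\<And>x. x \<in> S \<Longrightarrow> f x = g x" "higher_differentiable_on S r f"
  shows "higher_differentiable_on S r g"
  using assms(2,3)
proof (induction r arbitrary: f g)
  case 0
  then show ?case using continuous_on_cong by (auto simp: continuous_on_eq)
next
  case (Suc r)
  have *: "frechet_derivative f (at x) = frechet_derivative g (at x)" "g differentiable (at x)"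
    if "x \<in> S" for x
  proof -
    have f: "f differentiable (at x)" using Suc.prems that by auto
    then show "frechet_derivative f (at x) = frechet_derivative g (at x)"
      using frechet_derivative_transform_within_open[OF f assms(1) that] Suc.prems(1) by blast
    show "g differentiable (at x)"
      using f assms(1) that Suc.prems(1)
      by (meson differentiable_def has_derivative_transform_within_open)
  qed
  have "higher_differentiable_on S r (\<lambda>x. frechet_derivative g (at x) v)" for v
    by (rule Suc.IH[of "\<lambda>x. frechet_derivative f (at x) v"]) (use * Suc.prems in auto)
  with * show ?case by auto
qed

text \<open>The derivative is given explicitly here, so that closure properties can be proved without
  computing \<^const>\<open>frechet_derivative\<close>.\<close>

lemma higher_differentiable_on_SucI:
  assumes "open S" "\<And>x. x \<in> S \<Longrightarrow> (f has_derivative f' x) (at x)"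
    and "\<And>v. higher_differentiable_on S r (\<lambda>x. f' x v)"
  shows "higher_differentiable_on S (Suc r) f"
proof -
  have "frechet_derivative f (at x) = f' x" if "x \<in> S" for x
    using frechet_derivative_at[OF assms(2)[OF that]] by simp
  moreover have "f differentiable (at x)" if "x \<in> S" for x
    using assms(2)[OF that] by (auto simp: differentiable_def)
  ultimately show ?thesis
    by (auto intro!: higher_differentiable_on_cong[OF assms(1) _ assms(3)])
qed

lemma higher_differentiable_on_SucD:
  assumes "higher_differentiable_on S (Suc r) f"
  shows "x \<in> S \<Longrightarrow> (f has_derivative frechet_derivative f (at x)) (at x)"
    and "higher_differentiable_on S r (\<lambda>x. frechet_derivative f (at x) v)"
  using assms frechet_derivative_works by auto

lemma higher_differentiable_on_const:
  "higher_differentiable_on S r (\<lambda>x. c)"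
  by (induction r arbitrary: c) auto

lemma higher_differentiable_on_add:
  assumes "open S" "higher_differentiable_on S r f" "higher_differentiable_on S r g"
  shows "higher_differentiable_on S r (\<lambda>x. f x + g x)"
  using assms(2,3)
proof (induction r arbitrary: f g)
  case 0
  then show ?case by (auto intro: continuous_intros)
next
  case (Suc r)
  show ?case
    by (rule higher_differentiable_on_SucI[OF assms(1)
          has_derivative_add[OF Suc.prems[THEN higher_differentiable_on_SucD(1)]]
          Suc.IH[OF Suc.prems[THEN higher_differentiable_on_SucD(2)]]])
qed

lemma higher_differentiable_on_scaleR:
  fixes f :: "'a::real_normed_vector \<Rightarrow> real" and g :: "'a \<Rightarrow> 'b::real_normed_vector"
  assumes "open S" "higher_differentiable_on S r f" "higher_differentiable_on S r g"
  shows "higher_differentiable_on S r (\<lambda>x. f x *\<^sub>R g x)"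
  using assms(2,3)
proof (induction r arbitrary: f g)
  case 0
  then show ?case by (auto intro: continuous_intros)
next
  case (Suc r)
  note D = Suc.prems[THEN higher_differentiable_on_SucD(1)]
  note D' = Suc.prems[THEN higher_differentiable_on_SucD(2)]
  show ?case
    by (rule higher_differentiable_on_SucI[OF assms(1) has_derivative_scaleR[OF D]])
      (auto intro!: higher_differentiable_on_add assms(1) Suc.IH D'
        Suc.prems[THEN higher_differentiable_on_Suc])
qed

lemma higher_differentiable_on_linear_comp:
  assumes "bounded_linear L" "open S" "higher_differentiable_on S r f"
  shows "higher_differentiable_on S r (\<lambda>x. L (f x))"
  using assms(3)
proof (induction r arbitrary: f)
  case 0
  then show ?case using assms(1) by (auto intro: bounded_linear.continuous_on)
next
  case (Suc r)
  show ?case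
    by (rule higher_differentiable_on_SucI[OF assms(2)
          bounded_linear.has_derivative[OF assms(1) Suc.prems[THEN higher_differentiable_on_SucD(1)]]
          Suc.IH[OF Suc.prems[THEN higher_differentiable_on_SucD(2)]]])
qed

lemma higher_differentiable_on_comp_linear:
  assumes "bounded_linear L" "open S" "open T" "L ` T \<subseteq> S" "higher_differentiable_on S r f"
  shows "higher_differentiable_on T r (\<lambda>x. f (L x))"
  using assms(5)
proof (induction r arbitrary: f)
  case 0
  then show ?case using assms(1,4)
    by (auto intro: continuous_on_compose2[OF _ linear_continuous_on])
next
  case (Suc r)
  show ?case
  proof (rule higher_differentiable_on_SucI[OF assms(3)])
    fix x assume "x \<in> T"
    then have "L x \<in> S" using assms(4) by auto
    then show "((\<lambda>x. f (L x)) has_derivative (\<lambda>v. frechet_derivative f (at (L x)) (L v))) (at x)"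
      using diff_chain_at[OF bounded_linear_imp_has_derivative[OF assms(1)]
          higher_differentiable_on_SucD(1)[OF Suc.prems]]
      by (simp add: o_def)
  qed (rule Suc.IH[OF Suc.prems[THEN higher_differentiable_on_SucD(2)]])
qed

lemma higher_differentiable_on_comp_real:
  fixes f :: "'a::real_normed_vector \<Rightarrow> real" and g :: "real \<Rightarrow> real"
  assumes "open S" "open T" "f ` S \<subseteq> T"
    and "\<And>r. higher_differentiable_on S r f" "\<And>r. higher_differentiable_on T r g"
  shows "higher_differentiable_on S r (\<lambda>x. g (f x))"
  using assms(5)
proof (induction r arbitrary: g)
  case 0
  then show ?case using assms(3) assms(4)[of 0]
    by (auto intro!: continuous_on_compose2[of T g S f] higher_differentiable_on_continuous[of T 0])
next
  case (Suc r)
  define g' where "g' y = frechet_derivative g (at y) 1" for y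
  have g': "(g has_derivative (\<lambda>h. h * g' y)) (at y)" if "y \<in> T" for y
  proof -
    have "(g has_derivative frechet_derivative g (at y)) (at y)"
      using higher_differentiable_on_SucD(1)[OF Suc.prems that] .
    moreover from this have "frechet_derivative g (at y) h = h * g' y" for h
      unfolding g'_def using linear_cmul[OF has_derivative_linear, of g _ "at y" h 1] by simp
    ultimately show ?thesis by (metis (no_types, lifting) ext)
  qed
  show ?case
  proof (rule higher_differentiable_on_SucI[OF assms(1)])
    fix x assume "x \<in> S"
    then show "((\<lambda>x. g (f x)) has_derivative (\<lambda>v. frechet_derivative f (at x) v *\<^sub>R g' (f x))) (at x)"
      using diff_chain_at[OF higher_differentiable_on_SucD(1)[OF assms(4)[of "Suc 0"]] g'] assms(3)
      by (auto simp: o_def)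
  next
    fix v
    have "higher_differentiable_on S r (\<lambda>x. g' (f x))"
      by (rule Suc.IH) (use higher_differentiable_on_SucD(2)[OF Suc.prems] in \<open>simp add: g'_def\<close>)
    then show "higher_differentiable_on S r (\<lambda>x. frechet_derivative f (at x) v *\<^sub>R g' (f x))"
      using assms(1) higher_differentiable_on_SucD(2)[OF assms(4)[of "Suc r"]]
      by (intro higher_differentiable_on_scaleR) auto
  qed
qed

lemma higher_differentiable_on_Un:
  assumes "open S" "open T" "higher_differentiable_on S r f" "higher_differentiable_on T r f"
  shows "higher_differentiable_on (S \<union> T) r f"
  using assms(3,4)
  by (induction r arbitrary: f) (use assms(1,2) in \<open>auto intro: continuous_on_open_Un\<close>)

lemma smooth_on_continuous: "smooth_on S f \<Longrightarrow> continuous_on S f"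
  unfolding smooth_on_def using higher_differentiable_on_continuous by blast

lemma smooth_onD:
  assumes "smooth_on S f"
  shows "x \<in> S \<Longrightarrow> f differentiable (at x)"
    and "x \<in> S \<Longrightarrow> (f has_derivative frechet_derivative f (at x)) (at x)"
    and "smooth_on S (\<lambda>x. frechet_derivative f (at x) v)"
proof -
  have *: "higher_differentiable_on S (Suc r) f" for r
    using assms unfolding smooth_on_def by blast
  show "x \<in> S \<Longrightarrow> f differentiable (at x)" using *[of 0] by simp
  then show "x \<in> S \<Longrightarrow> (f has_derivative frechet_derivative f (at x)) (at x)"
    by (simp add: frechet_derivative_works)
  show "smooth_on S (\<lambda>x. frechet_derivative f (at x) v)"
    using * unfolding smooth_on_def by simp
qed

lemma smooth_onI:
  assumes "open S" "\<And>x. x \<in> S \<Longrightarrow> (f has_derivative f' x) (at x)"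
    and "\<And>v. smooth_on S (\<lambda>x. f' x v)"
  shows "smooth_on S f"
proof -
  have "higher_differentiable_on S (Suc r) f" for r
    using assms by (intro higher_differentiable_on_SucI) (auto simp: smooth_on_def)
  then show ?thesis
    unfolding smooth_on_def using higher_differentiable_on_Suc by blast
qed

lemma smooth_on_subset: "smooth_on S f \<Longrightarrow> T \<subseteq> S \<Longrightarrow> smooth_on T f"
proof -
  have "higher_differentiable_on S r f \<Longrightarrow> T \<subseteq> S \<Longrightarrow> higher_differentiable_on T r f" for r
    by (induction r arbitrary: f) (auto intro: continuous_on_subset)
  then show "smooth_on S f \<Longrightarrow> T \<subseteq> S \<Longrightarrow> smooth_on T f" by (auto simp: smooth_on_def)
qed

lemma smooth_on_cong:
  "open S \<Longrightarrow> (\<And>x. x \<in> S \<Longrightarrow> f x = g x) \<Longrightarrow> smooth_on S f \<Longrightarrow> smooth_on S g"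
  unfolding smooth_on_def using higher_differentiable_on_cong by blast

lemma smooth_on_const: "smooth_on S (\<lambda>x. c)"
  by (simp add: smooth_on_def higher_differentiable_on_const)

lemma smooth_on_add:
  "open S \<Longrightarrow> smooth_on S f \<Longrightarrow> smooth_on S g \<Longrightarrow> smooth_on S (\<lambda>x. f x + g x)"
  by (simp add: smooth_on_def higher_differentiable_on_add)

lemma smooth_on_scaleR:
  fixes f :: "'a::real_normed_vector \<Rightarrow> real"
  shows "open S \<Longrightarrow> smooth_on S f \<Longrightarrow> smooth_on S g \<Longrightarrow> smooth_on S (\<lambda>x. f x *\<^sub>R g x)"
  by (simp add: smooth_on_def higher_differentiable_on_scaleR)

lemma smooth_on_mult:
  fixes f g :: "'a::real_normed_vector \<Rightarrow> real"
  shows "open S \<Longrightarrow> smooth_on S f \<Longrightarrow> smooth_on S g \<Longrightarrow> smooth_on S (\<lambda>x. f x * g x)"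
  using smooth_on_scaleR[of S f g] by simp

lemma smooth_on_sum:
  "open S \<Longrightarrow> (\<And>i. i \<in> I \<Longrightarrow> smooth_on S (f i)) \<Longrightarrow> smooth_on S (\<lambda>x. \<Sum>i\<in>I. f i x)"
  by (induction I rule: infinite_finite_induct) (auto intro: smooth_on_const smooth_on_add)

lemma smooth_on_linear_comp:
  "bounded_linear L \<Longrightarrow> open S \<Longrightarrow> smooth_on S f \<Longrightarrow> smooth_on S (\<lambda>x. L (f x))"
  by (simp add: smooth_on_def higher_differentiable_on_linear_comp)

lemma smooth_on_comp_linear:
  "bounded_linear L \<Longrightarrow> open S \<Longrightarrow> open T \<Longrightarrow> L ` T \<subseteq> S \<Longrightarrow> smooth_on S f \<Longrightarrow>
    smooth_on T (\<lambda>x. f (L x))"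
  unfolding smooth_on_def using higher_differentiable_on_comp_linear by blast

lemma smooth_on_comp_real:
  fixes f :: "'a::real_normed_vector \<Rightarrow> real" and g :: "real \<Rightarrow> real"
  assumes "open S" "open T" "f ` S \<subseteq> T" "smooth_on S f" "smooth_on T g"
  shows "smooth_on S (\<lambda>x. g (f x))"
  using higher_differentiable_on_comp_real[OF assms(1-3)] assms(4,5) by (simp add: smooth_on_def)

lemma smooth_on_Un:
  "open S \<Longrightarrow> open T \<Longrightarrow> smooth_on S f \<Longrightarrow> smooth_on T f \<Longrightarrow> smooth_on (S \<union> T) f"
  by (simp add: smooth_on_def higher_differentiable_on_Un)

lemma smooth_on_linear: "bounded_linear L \<Longrightarrow> open S \<Longrightarrow> smooth_on S L"
  by (rule smooth_onI) (auto intro: bounded_linear_imp_has_derivative smooth_on_const)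

lemma smooth_on_inner_self:
  "smooth_on UNIV (\<lambda>x::'a::real_inner. x \<bullet> x)"
proof (rule smooth_onI)
  show "((\<lambda>x. x \<bullet> x) has_derivative (\<lambda>v. (2 * (x \<bullet> v)))) (at x)" for x :: 'a
    by (auto intro!: derivative_eq_intros simp: inner_commute)
  show "smooth_on UNIV (\<lambda>x::'a. 2 * (x \<bullet> v))" for v
    by (rule smooth_on_linear)
      (auto intro: bounded_linear_const_mult bounded_linear_inner_left)
qed simp

lemma smooth_on_powr: "smooth_on {0<..} (\<lambda>t::real. t powr a)"
proof -
  have "higher_differentiable_on {0<..} r (\<lambda>t::real. c * t powr a)" for r c
  proof (induction r arbitrary: a c)
    case 0
    show ?case by (auto intro!: continuous_intros)
  next
    case (Suc r)
    have "higher_differentiable_on {0<..} r (\<lambda>t::real. (v * c * a) * t powr (a - 1))" for v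
      by (rule Suc)
    then show ?case
      by (intro higher_differentiable_on_SucI[where f' = "\<lambda>t v. (v * c * a) * t powr (a - 1)"])
        (auto intro!: derivative_eq_intros simp: powr_diff)
  qed
  from this[of _ 1] show ?thesis by (simp add: smooth_on_def)
qed

lemma smooth_on_ln: "smooth_on {0<..} (ln :: real \<Rightarrow> real)"
proof (rule smooth_onI)
  show "(ln has_derivative (\<lambda>v. t powr (-1) * v)) (at t)" if "t \<in> {0<..}" for t :: real
    using that by (auto intro!: derivative_eq_intros simp: powr_minus_divide divide_simps)
  show "smooth_on {0<..} (\<lambda>t::real. t powr (-1) * v)" for v
    by (intro smooth_on_mult smooth_on_powr smooth_on_const) auto
qed simp

section \<open>Test functions\<close>

lemma test_functionsI:
  fixes \<phi> :: "'a::real_normed_vector \<Rightarrow> real"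
  assumes "smooth_on UNIV \<phi>" "compact K" "K \<subseteq> U" "\<And>x. x \<notin> K \<Longrightarrow> \<phi> x = 0"
  shows "\<phi> \<in> test_functions U"
proof -
  have "closure {x. \<phi> x \<noteq> 0} \<subseteq> K"
    using assms by (intro closure_minimal) (auto intro: compact_imp_closed)
  moreover from this have "compact (closure {x. \<phi> x \<noteq> 0})"
    using compact_Int_closed[OF assms(2) closed_closure[of "{x. \<phi> x \<noteq> 0}"]]
    by (simp add: Int_absorb1)
  ultimately show ?thesis
    using assms by (auto simp: test_functions_def)
qed

lemma test_functionsE:
  assumes "\<phi> \<in> test_functions U"
  obtains K where "smooth_on UNIV \<phi>" "compact K" "K \<subseteq> U" "\<And>x. x \<notin> K \<Longrightarrow> \<phi> x = 0"
proof (rule that)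
  show "\<phi> x = 0" if "x \<notin> closure {x. \<phi> x \<noteq> 0}" for x
    using that closure_subset[of "{x. \<phi> x \<noteq> 0}"] by auto
qed (use assms in \<open>simp_all add: test_functions_def\<close>)

lemma test_functions_mono: "U \<subseteq> W \<Longrightarrow> test_functions U \<subseteq> test_functions W"
  by (auto simp: test_functions_def)

lemma test_functions_smooth: "\<phi> \<in> test_functions U \<Longrightarrow> smooth_on UNIV \<phi>"
  by (simp add: test_functions_def)

text \<open>Smoothness on \<open>U\<close> is enough, because the open sets \<open>U\<close> and \<open>- K\<close> cover the space and the
  function vanishes on the latter.\<close>

lemma test_functions_localI:
  fixes \<phi> :: "'a::real_normed_vector \<Rightarrow> real"
  assumes "open U" "smooth_on U \<phi>" "compact K" "K \<subseteq> U" "\<And>x. x \<notin> K \<Longrightarrow> \<phi> x = 0"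
  shows "\<phi> \<in> test_functions U"
proof -
  have o: "open (- K)" using assms(3) by (simp add: open_Compl compact_imp_closed)
  have "smooth_on (- K) \<phi>"
    by (rule smooth_on_cong[OF o _ smooth_on_const[of _ 0]]) (use assms(5) in auto)
  then have "smooth_on (U \<union> - K) \<phi>"
    by (rule smooth_on_Un[OF assms(1) o assms(2)])
  moreover have "U \<union> - K = UNIV" using assms(4) by auto
  ultimately show ?thesis using assms(3-5) by (intro test_functionsI[of _ K]) auto
qed

lemma test_functions_mult:
  assumes \<phi>: "\<phi> \<in> test_functions U" and g: "smooth_on U g" and U: "open U"
  shows "(\<lambda>x. g x * \<phi> x) \<in> test_functions U"
proof -
  obtain K where K: "smooth_on UNIV \<phi>" "compact K" "K \<subseteq> U" "\<And>x. x \<notin> K \<Longrightarrow> \<phi> x = 0"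
    using \<phi> by (rule test_functionsE) (rule that)
  have "smooth_on U (\<lambda>x. g x * \<phi> x)"
    using g K(1) U by (intro smooth_on_mult) (auto intro: smooth_on_subset)
  then show ?thesis using K by (intro test_functions_localI[OF U, of _ K]) auto
qed

lemma frechet_derivative_eq_0_outside:
  assumes "closed K" "\<And>x. x \<notin> K \<Longrightarrow> f x = 0" "x \<notin> K"
  shows "frechet_derivative f (at x) = (\<lambda>_. 0)"
  using frechet_derivative_transform_within_open[of "\<lambda>_. 0" x "- K" f] assms
  by (auto simp: open_Compl)

lemma test_functions_derivative:
  assumes \<phi>: "\<phi> \<in> test_functions U"
  shows "(\<lambda>x. frechet_derivative \<phi> (at x) v) \<in> test_functions U"
proof -
  obtain K where K: "smooth_on UNIV \<phi>" "compact K" "K \<subseteq> U" "\<And>x. x \<notin> K \<Longrightarrow> \<phi> x = 0"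
    using \<phi> by (rule test_functionsE) (rule that)
  show ?thesis
    by (rule test_functionsI[of _ K])
      (use K frechet_derivative_eq_0_outside[of K \<phi>] in
        \<open>auto simp: compact_imp_closed intro: smooth_onD\<close>)
qed

lemma test_functions_add:
  assumes "\<phi> \<in> test_functions U" "\<psi> \<in> test_functions U"
  shows "(\<lambda>x. \<phi> x + \<psi> x) \<in> test_functions U"
proof -
  obtain K where K: "smooth_on UNIV \<phi>" "compact K" "K \<subseteq> U" "\<And>x. x \<notin> K \<Longrightarrow> \<phi> x = 0"
    using assms(1) by (rule test_functionsE) (rule that)
  obtain L where L: "smooth_on UNIV \<psi>" "compact L" "L \<subseteq> U" "\<And>x. x \<notin> L \<Longrightarrow> \<psi> x = 0"
    using assms(2) by (rule test_functionsE) (rule that)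
  show ?thesis
    by (rule test_functionsI[of _ "K \<union> L"]) (use K L in \<open>auto intro: smooth_on_add\<close>)
qed

lemma test_functions_sum:
  fixes \<phi> :: "'i \<Rightarrow> 'a::real_normed_vector \<Rightarrow> real"
  shows "(\<And>i. i \<in> I \<Longrightarrow> \<phi> i \<in> test_functions U) \<Longrightarrow> (\<lambda>x. \<Sum>i\<in>I. \<phi> i x) \<in> test_functions U"
proof (induction I rule: infinite_finite_induct)
  case (insert i I)
  then show ?case by (simp add: test_functions_add)
qed (simp_all add: test_functionsI[of "\<lambda>_. 0" "{}"] smooth_on_const)

lemma integrable_compact_support:
  fixes f :: "'a::euclidean_space \<Rightarrow> real"
  assumes "compact K" "continuous_on K f" "\<And>x. x \<notin> K \<Longrightarrow> f x = 0"
  shows "integrable lborel f"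
proof -
  have "(\<lambda>x. indicator K x *\<^sub>R f x) = f"
    using assms(3) by (intro ext) (auto simp: indicator_def)
  then show ?thesis
    using borel_integrable_compact[OF assms(1,2)] by simp
qed

text \<open>The weights below are powers of a homogeneous norm, with a singularity at \<open>0\<close>; the set \<open>U\<close>
  will be the complement of \<open>0\<close>.\<close>

lemma integrable_weighted_test_function:
  fixes g :: "'a::euclidean_space \<Rightarrow> real"
  assumes "\<phi> \<in> test_functions U" "continuous_on U g"
  shows "integrable lborel (\<lambda>x. g x * \<phi> x)"
proof -
  obtain K where K: "smooth_on UNIV \<phi>" "compact K" "K \<subseteq> U" "\<And>x. x \<notin> K \<Longrightarrow> \<phi> x = 0"
    using assms(1) by (rule test_functionsE) (rule that)
  show ?thesis
    by (rule integrable_compact_support[OF K(2)])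
      (use K assms(2) in \<open>auto intro!: continuous_intros continuous_on_subset[of U g]
        continuous_on_subset[OF smooth_on_continuous[OF K(1)]]\<close>)
qed

lemma test_functions_integrable:
  fixes \<phi> :: "'a::euclidean_space \<Rightarrow> real"
  shows "\<phi> \<in> test_functions U \<Longrightarrow> integrable lborel \<phi>"
  using integrable_weighted_test_function[of \<phi> U "\<lambda>_. 1"] by simp

section \<open>A smooth bump on the line\<close>

text \<open>The family \<open>flat k\<close>, \<open>t\<^sup>-\<^sup>k exp (- 1 / t)\<close> extended by zero, is closed under differentiation
  up to linear combinations; hence all its members are smooth, including at \<open>0\<close>.\<close>

definition flat :: "nat \<Rightarrow> real \<Rightarrow> real" where
  "flat k t = (if t > 0 then exp (- 1 / t) / t ^ k else 0)"

lemma flat_le: "\<bar>flat k t\<bar> \<le> fact (Suc k) * \<bar>t\<bar>"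
proof (cases "t > 0")
  case True
  \<comment> \<open>Compare with one term of the exponential series.\<close>
  have "(1 / t) ^ Suc k / fact (Suc k) \<le> exp (1 / t)"
  proof -
    have "(\<Sum>n\<in>{Suc k}. inverse (fact n) *\<^sub>R (1 / t) ^ n) \<le> (\<Sum>n. inverse (fact n) *\<^sub>R (1 / t) ^ n)"
      using True by (intro sum_le_suminf summable_exp_generic) auto
    then show ?thesis by (simp add: exp_def field_simps)
  qed
  then have "1 \<le> fact (Suc k) * t * (exp (1 / t) * t ^ k)"
    using True by (simp add: power_one_over divide_simps mult_ac)
  moreover have "flat k t = 1 / (exp (1 / t) * t ^ k)"
    using True by (simp add: flat_def exp_minus field_simps)
  ultimately have "flat k t \<le> fact (Suc k) * t"
    using True by (simp add: divide_le_eq)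
  then show ?thesis using True by (simp add: flat_def)
qed (simp add: flat_def mult_nonneg_nonpos)

lemma flat_has_derivative:
  "(flat k has_real_derivative flat (Suc (Suc k)) t - k * flat (Suc k) t) (at t)"
proof -
  consider "t > 0" | "t < 0" | "t = 0" by linarith
  then show ?thesis
  proof cases
    case 1
    have "((\<lambda>t. exp (- 1 / t) / t ^ k) has_real_derivative flat (Suc (Suc k)) t - k * flat (Suc k) t) (at t)"
      using 1 by (auto intro!: derivative_eq_intros simp: flat_def, cases k)
        (auto simp: field_simps power2_eq_square)
    then show ?thesis
      by (rule has_field_derivative_transform_within_open[of _ _ _ "{0<..}"])
        (use 1 in \<open>auto simp: flat_def\<close>)
  next
    case 2
    have "((\<lambda>_. 0) has_real_derivative flat (Suc (Suc k)) t - k * flat (Suc k) t) (at t)"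
      using 2 by (simp add: flat_def)
    then show ?thesis
      by (rule has_field_derivative_transform_within_open[of _ _ _ "{..<0}"])
        (use 2 in \<open>auto simp: flat_def\<close>)
  next
    case 3
    \<comment> \<open>The difference quotient of \<open>flat k\<close> at \<open>0\<close> is \<open>flat (Suc k)\<close>.\<close>
    have "((\<lambda>h. flat (Suc k) h) \<longlongrightarrow> 0) (at 0)"
    proof (rule Lim_null_comparison)
      show "\<forall>\<^sub>F h in at 0. norm (flat (Suc k) h) \<le> fact (Suc (Suc k)) * \<bar>h\<bar>"
        using flat_le[of "Suc k"] by (intro always_eventually) auto
      show "((\<lambda>h. fact (Suc (Suc k)) * \<bar>h\<bar>) \<longlongrightarrow> (0::real)) (at 0)"
        by (auto intro!: tendsto_eq_intros)
    qed
    moreover have "(flat k h - flat k 0) / (h - 0) = flat (Suc k) h" for h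
      by (auto simp: flat_def)
    ultimately show ?thesis
      using 3 by (simp add: has_field_derivative_iff flat_def)
  qed
qed

lemma smooth_on_flat: "smooth_on UNIV (flat k)"
proof -
  have "higher_differentiable_on UNIV r (\<lambda>t. flat k t)" for r
  proof (induction r arbitrary: k)
    case 0
    show ?case using flat_has_derivative
      by (auto intro!: continuous_at_imp_continuous_on DERIV_isCont)
  next
    case (Suc r)
    have "higher_differentiable_on UNIV r
            (\<lambda>t. v *\<^sub>R (flat (Suc (Suc k)) t + (- real k) *\<^sub>R flat (Suc k) t))" for v :: real
      by (intro higher_differentiable_on_scaleR higher_differentiable_on_add
          higher_differentiable_on_const Suc open_UNIV)
    moreover have "(flat k has_derivative
        (\<lambda>v. v *\<^sub>R (flat (Suc (Suc k)) t + (- real k) *\<^sub>R flat (Suc k) t))) (at t)" for t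
      using flat_has_derivative[of k t] by (simp add: has_field_derivative_def mult_commute_abs)
    ultimately show ?case
      by (intro higher_differentiable_on_SucI[OF open_UNIV])
  qed
  then show ?thesis by (simp add: smooth_on_def)
qed

definition bump :: "real \<Rightarrow> real" where
  "bump t = flat 0 (1 + t) * flat 0 (1 - t)"

lemma smooth_on_bump: "smooth_on UNIV bump"
proof -
  have "smooth_on UNIV (\<lambda>t. c * t + d)" for c d :: real
    by (intro smooth_on_add smooth_on_const smooth_on_linear bounded_linear_mult_right open_UNIV)
  then have *: "smooth_on UNIV (\<lambda>t. flat 0 (c * t + d))" for c d
    by (intro smooth_on_comp_real[OF open_UNIV open_UNIV subset_UNIV _ smooth_on_flat])
  have "bump = (\<lambda>t. flat 0 (1 * t + 1) * flat 0 (- 1 * t + 1))"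
    by (simp add: bump_def fun_eq_iff add.commute)
  then show ?thesis
    using smooth_on_mult[OF open_UNIV *[of 1 1] *[of "- 1" 1]] by (simp only:)
qed

lemma bump_eq_0: "\<bar>t\<bar> \<ge> 1 \<Longrightarrow> bump t = 0"
  by (auto simp: bump_def flat_def)

lemma bump_pos: "\<bar>t\<bar> < 1 \<Longrightarrow> bump t > 0"
  by (auto simp: bump_def flat_def)

text \<open>Composing with the square of the norm gives bumps in any dimension.\<close>

lemma test_function_at_0_exists:
  "\<exists>\<phi> \<in> test_functions (UNIV :: 'a::euclidean_space set). \<phi> 0 \<noteq> 0"
proof
  show "(\<lambda>x::'a. bump (x \<bullet> x)) \<in> test_functions UNIV"
  proof (rule test_functionsI[of _ "cball 0 1"])
    show "smooth_on UNIV (\<lambda>x::'a. bump (x \<bullet> x))"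
      by (rule smooth_on_comp_real[OF open_UNIV open_UNIV _ smooth_on_inner_self smooth_on_bump]) auto
    show "bump (x \<bullet> x) = 0" if "x \<notin> cball 0 1" for x :: 'a
      using that by (intro bump_eq_0) (auto simp: dot_square_norm)
  qed auto
  show "bump ((0::'a) \<bullet> 0) \<noteq> 0" using bump_pos[of 0] by simp
qed

section \<open>Integration of derivatives of test functions\<close>

text \<open>The difference quotients of \<open>\<phi>\<close> have integral zero by translation invariance, and they are
  dominated: the mean value theorem bounds them by the maximum of the derivative.\<close>

lemma integral_derivative_test_function:
  fixes \<phi> :: "'a::euclidean_space \<Rightarrow> real"
  assumes \<phi>: "\<phi> \<in> test_functions UNIV"
  shows "(LINT x|lborel. frechet_derivative \<phi> (at x) v) = 0"
proof -
  obtain K where K: "smooth_on UNIV \<phi>" "compact K" "\<And>x. x \<notin> K \<Longrightarrow> \<phi> x = 0"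
    using \<phi> by (rule test_functionsE) (rule that)
  let ?D = "\<lambda>x. frechet_derivative \<phi> (at x) v"
  define h where "h n = inverse (real (Suc n))" for n
  define d where "d n x = (\<phi> (h n *\<^sub>R v + x) - \<phi> x) / h n" for n x
  have h: "0 < h n" "h n \<le> 1" for n by (auto simp: h_def field_simps)
  have h0: "h \<longlonglongrightarrow> 0" unfolding h_def by (rule LIMSEQ_inverse_real_of_nat)
  have cont: "continuous_on UNIV \<phi>" "continuous_on UNIV ?D"
    using K(1) smooth_onD(3) smooth_on_continuous by blast+
  have [measurable]: "\<phi> \<in> borel_measurable borel" "?D \<in> borel_measurable borel"
    using cont by (simp_all add: borel_measurable_continuous_onI)
  have D: "((\<lambda>t. \<phi> (x + t *\<^sub>R v)) has_real_derivative ?D (x + t *\<^sub>R v)) (at t)" for x t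
  proof -
    have "((\<lambda>t. x + t *\<^sub>R v) has_derivative (\<lambda>s. s *\<^sub>R v)) (at t)"
      by (auto intro!: derivative_eq_intros)
    from diff_chain_at[OF this smooth_onD(2)[OF K(1) UNIV_I]]
    have "((\<lambda>t. \<phi> (x + t *\<^sub>R v)) has_derivative
        (\<lambda>s. frechet_derivative \<phi> (at (x + t *\<^sub>R v)) (s *\<^sub>R v))) (at t)"
      by (simp add: o_def)
    moreover have "frechet_derivative \<phi> (at y) (s *\<^sub>R v) = s * ?D y" for s y
      using linear_cmul[OF linear_frechet_derivative[OF smooth_onD(1)[OF K(1) UNIV_I]]] by simp
    ultimately show ?thesis
      by (simp add: has_field_derivative_def mult_commute_abs)
  qed
  have D0: "?D x = 0" if "x \<notin> K" for x
    using frechet_derivative_eq_0_outside[of K \<phi> x] K that by (auto simp: compact_imp_closed)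
  obtain M where M: "\<And>x. \<bar>?D x\<bar> \<le> M"
  proof -
    have "compact (?D ` K)"
      using K(2) cont(2) by (intro compact_continuous_image) (auto intro: continuous_on_subset)
    then obtain M where M: "\<forall>x\<in>K. \<bar>?D x\<bar> \<le> M"
      by (auto dest!: compact_imp_bounded simp: bounded_iff)
    have "\<bar>?D x\<bar> \<le> max M 0" for x
    proof (cases "x \<in> K")
      case True
      then show ?thesis using M by (simp add: le_max_iff_disj)
    qed (simp add: D0)
    then show ?thesis using that by blast
  qed
  define K' where "K' = (\<lambda>(x, t). x - t *\<^sub>R v) ` (K \<times> {0..1})"
  have K': "compact K'"
    unfolding K'_def using K(2)
    by (intro compact_continuous_image compact_Times) (auto intro!: continuous_intros simp: split_beta)
  have d_bound: "norm (d n x) \<le> indicator K' x *\<^sub>R M" for n x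
  proof (cases "x \<in> K'")
    case True
    obtain z where "\<phi> (x + h n *\<^sub>R v) - \<phi> (x + 0 *\<^sub>R v) = (h n - 0) * ?D (x + z *\<^sub>R v)"
      using MVT2[OF h(1)[of n], of "\<lambda>t. \<phi> (x + t *\<^sub>R v)" "\<lambda>t. ?D (x + t *\<^sub>R v)"] D by blast
    then have "d n x = ?D (x + z *\<^sub>R v)"
      unfolding d_def using h(1)[of n] by (simp add: add.commute)
    then show ?thesis using M True by simp
  next
    case False
    have "x = (x + t *\<^sub>R v) - t *\<^sub>R v" for t by simp
    then have "x + t *\<^sub>R v \<notin> K" if "t \<in> {0..1}" for t
      using that False unfolding K'_def by (metis (no_types, lifting) SigmaI case_prod_conv image_eqI)
    from this[of "h n"] this[of 0] show ?thesis
      using K(3) h[of n] False by (auto simp: d_def add.commute)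
  qed
  have "(\<lambda>n. LINT x|lborel. d n x) \<longlonglongrightarrow> (LINT x|lborel. ?D x)"
  proof (rule integral_dominated_convergence[where w = "\<lambda>x. indicator K' x *\<^sub>R M"])
    show "integrable lborel (\<lambda>x. indicator K' x *\<^sub>R M)"
      by (rule borel_integrable_compact[OF K']) auto
    show "AE x in lborel. (\<lambda>n. d n x) \<longlonglongrightarrow> ?D x"
    proof (intro AE_I2)
      fix x
      have "((\<lambda>t. (\<phi> (x + t *\<^sub>R v) - \<phi> x) / t) \<longlongrightarrow> ?D x) (at 0)"
        using D[of x 0] by (simp add: has_field_derivative_iff)
      moreover have "filterlim h (at 0) sequentially"
        using h0 h(1) by (auto simp: filterlim_at intro!: always_eventually) (metis less_irrefl)
      ultimately show "(\<lambda>n. d n x) \<longlonglongrightarrow> ?D x"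
        unfolding d_def add.commute[of _ x] by (rule filterlim_compose)
    qed
  qed (use d_bound in \<open>auto simp: d_def\<close>)
  moreover have "(LINT x|lborel. d n x) = 0" for n
  proof -
    have i: "integrable lborel \<phi>" using test_functions_integrable[OF \<phi>] .
    have eq: "(LINT x|lborel. \<phi> (h n *\<^sub>R v + x)) = (LINT x|lborel. \<phi> x)"
      by (subst (2) lborel_distr_plus[of "h n *\<^sub>R v", symmetric]) (simp add: integral_distr)
    have "integrable lborel (\<lambda>x. \<phi> (h n *\<^sub>R v + x))"
      using i by (subst (asm) lborel_distr_plus[of "h n *\<^sub>R v", symmetric]) (simp add: integrable_distr_eq)
    then show ?thesis unfolding d_def using i eq by simp
  qed
  ultimately show ?thesis by (simp add: LIMSEQ_const_iff)
qed

section \<open>Horizontal derivatives on a group with dilations\<close>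

lemma dilation_nth [simp]: "dilation wt r x $ i = r ^ wt i * x $ i"
  by (simp add: dilation_def)

lemma bounded_linear_dilation: "bounded_linear (dilation wt r)"
  unfolding dilation_def
  by (intro linear_conv_bounded_linear[THEN iffD1] linearI) (auto simp: vec_eq_iff algebra_simps)

lemma dilation_axis: "dilation wt r (axis j c) = r ^ wt j *\<^sub>R axis j c"
  by (auto simp: vec_eq_iff axis_def)

lemma dilation_inverse:
  "r \<noteq> 0 \<Longrightarrow> dilation wt (1 / r) (dilation wt r x) = x"
  by (auto simp: vec_eq_iff power_one_over)

lemma dilation_eq_0_iff: "r \<noteq> 0 \<Longrightarrow> dilation wt r x = 0 \<longleftrightarrow> x = 0"
  by (simp add: vec_eq_iff)

locale group_with_dilations =
  fixes mul :: "real^'n \<Rightarrow> real^'n \<Rightarrow> real^'n" and wt :: "'n \<Rightarrow> nat"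
  assumes group: "exponential_lie_group mul"
    and wt: "wt i \<ge> 1"
    and dilation_mul: "r > 0 \<Longrightarrow> dilation wt r (mul x y) = mul (dilation wt r x) (dilation wt r y)"
begin

abbreviation X :: "'n \<Rightarrow> (real^'n \<Rightarrow> real) \<Rightarrow> real^'n \<Rightarrow> real" where
  "X j \<equiv> left_inv_deriv mul (axis j 1)"

abbreviation vf :: "'n \<Rightarrow> real^'n \<Rightarrow> real^'n" where
  "vf j \<equiv> left_inv_field mul (axis j 1)"

lemma smooth_mul: "smooth_on UNIV (\<lambda>(x, y). mul x y)"
  using group by (simp add: exponential_lie_group_def)

lemma mul_0_right [simp]: "mul x 0 = x"
proof -
  have "mul (1 *\<^sub>R x) (0 *\<^sub>R x) = (1 + 0) *\<^sub>R x"
    using group unfolding exponential_lie_group_def by blast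
  then show ?thesis by simp
qed

lemma mul_has_derivative:
  "((\<lambda>y. mul x y) has_derivative (\<lambda>v. frechet_derivative (\<lambda>(x, y). mul x y) (at (x, 0)) (0, v))) (at 0)"
proof -
  have "((\<lambda>y. (x, y)) has_derivative (\<lambda>v. (0, v))) (at 0)"
    by (auto intro!: derivative_eq_intros)
  from diff_chain_at[OF this smooth_onD(2)[OF smooth_mul UNIV_I]] show ?thesis
    by (simp add: o_def)
qed

lemma left_inv_field_eq:
  "left_inv_field mul v x = frechet_derivative (\<lambda>(x, y). mul x y) (at (x, 0)) (0, v)"
  unfolding left_inv_field_def using frechet_derivative_at[OF mul_has_derivative[of x]] by metis

lemma has_derivative_left_inv_field:
  "((\<lambda>y. mul x y) has_derivative (\<lambda>v. left_inv_field mul v x)) (at 0)"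
  using mul_has_derivative unfolding left_inv_field_eq .

lemma left_inv_field_scaleR: "left_inv_field mul (c *\<^sub>R v) x = c *\<^sub>R left_inv_field mul v x"
  using linear_cmul[OF has_derivative_linear[OF has_derivative_left_inv_field]] .

lemma smooth_left_inv_field: "smooth_on UNIV (left_inv_field mul v)"
proof -
  have "bounded_linear (\<lambda>x::real^'n. (x, 0::real^'n))"
    by (rule bounded_linear_Pair[OF bounded_linear_ident bounded_linear_zero])
  from smooth_on_comp_linear[OF this open_UNIV open_UNIV _ smooth_onD(3)[OF smooth_mul, of "(0, v)"]]
  show ?thesis by (simp add: left_inv_field_eq[abs_def])
qed

lemma left_inv_deriv_expand:
  assumes "f differentiable (at x)"
  shows "X j f x = (\<Sum>i\<in>UNIV. vf j x $ i * frechet_derivative f (at x) (axis i 1))"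
proof -
  note l = linear_frechet_derivative[OF assms]
  have "X j f x = frechet_derivative f (at x) (\<Sum>i\<in>UNIV. vf j x $ i *\<^sub>R axis i 1)"
    unfolding left_inv_deriv_def using basis_expansion[of "vf j x"] by (simp add: scalar_mult_eq_scaleR)
  then show ?thesis by (simp add: linear_sum[OF l] linear_cmul[OF l])
qed

lemma smooth_left_inv_field_component: "smooth_on UNIV (\<lambda>x. vf j x $ i)"
  by (rule smooth_on_linear_comp[OF bounded_linear_vec_nth open_UNIV smooth_left_inv_field])

lemma smooth_left_inv_deriv:
  assumes "open S" "smooth_on S f"
  shows "smooth_on S (X j f)"
proof (rule smooth_on_cong[OF assms(1)])
  show "smooth_on S (\<lambda>x. \<Sum>i\<in>UNIV. vf j x $ i * frechet_derivative f (at x) (axis i 1))"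
    by (intro smooth_on_sum smooth_on_mult assms smooth_onD(3)
        smooth_on_subset[OF smooth_left_inv_field_component]) auto
  show "(\<Sum>i\<in>UNIV. vf j x $ i * frechet_derivative f (at x) (axis i 1)) = X j f x" if "x \<in> S" for x
    using left_inv_deriv_expand smooth_onD(1)[OF assms(2) that] by simp
qed

lemma left_inv_deriv_eq_0_outside:
  "closed K \<Longrightarrow> (\<And>x. x \<notin> K \<Longrightarrow> f x = 0) \<Longrightarrow> x \<notin> K \<Longrightarrow> X j f x = 0"
  using frechet_derivative_eq_0_outside[of K f x] by (simp add: left_inv_deriv_def)

lemma test_functions_left_inv_deriv:
  assumes "\<phi> \<in> test_functions U"
  shows "X j \<phi> \<in> test_functions U"
proof -
  obtain K where K: "smooth_on UNIV \<phi>" "compact K" "K \<subseteq> U" "\<And>x. x \<notin> K \<Longrightarrow> \<phi> x = 0"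
    using assms by (rule test_functionsE) (rule that)
  show ?thesis
    using K(2,3) left_inv_deriv_eq_0_outside[OF compact_imp_closed[OF K(2)] K(4)]
    by (intro test_functionsI[of _ K] smooth_left_inv_deriv K(1)) auto
qed

lemma left_inv_deriv_mult:
  assumes "f differentiable (at x)" "g differentiable (at x)"
  shows "X j (\<lambda>x. f x * g x) x = f x * X j g x + X j f x * g x"
proof -
  have "((\<lambda>x. f x * g x) has_derivative
      (\<lambda>v. f x * frechet_derivative g (at x) v + frechet_derivative f (at x) v * g x)) (at x)"
    using assms by (intro has_derivative_mult) (simp_all add: frechet_derivative_works)
  from frechet_derivative_at[OF this, symmetric] show ?thesis by (simp add: left_inv_deriv_def)
qed

lemma left_inv_deriv_chain:
  assumes "f differentiable (at x)" "(g has_real_derivative g') (at (f x))"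
  shows "X j (\<lambda>x. g (f x)) x = g' * X j f x"
proof -
  have "((\<lambda>x. g (f x)) has_derivative (\<lambda>v. g' * frechet_derivative f (at x) v)) (at x)"
    using diff_chain_at[OF frechet_derivative_works[THEN iffD1, OF assms(1)]
        assms(2)[unfolded has_field_derivative_def]] by (simp add: o_def)
  from frechet_derivative_at[OF this, symmetric] show ?thesis by (simp add: left_inv_deriv_def)
qed

text \<open>Dilations are automorphisms, so they scale the left-invariant fields.\<close>

lemma left_inv_field_dilation:
  assumes "r > 0"
  shows "dilation wt r (vf j x) = r ^ wt j *\<^sub>R vf j (dilation wt r x)"
proof -
  note L = bounded_linear_dilation[of wt r]
  have "((\<lambda>y. dilation wt r (mul x y)) has_derivative (\<lambda>v. dilation wt r (left_inv_field mul v x))) (at 0)"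
    by (rule bounded_linear.has_derivative[OF L has_derivative_left_inv_field])
  moreover have "((\<lambda>y. mul (dilation wt r x) (dilation wt r y)) has_derivative
      (\<lambda>v. left_inv_field mul (dilation wt r v) (dilation wt r x))) (at 0)"
    using diff_chain_at[OF bounded_linear_imp_has_derivative[OF L], of "mul (dilation wt r x)" _ 0]
      has_derivative_left_inv_field[of "dilation wt r x"]
    by (simp add: o_def linear_0[OF bounded_linear.linear[OF L]])
  ultimately have "(\<lambda>v. dilation wt r (left_inv_field mul v x))
      = (\<lambda>v. left_inv_field mul (dilation wt r v) (dilation wt r x))"
    unfolding dilation_mul[OF assms] by (rule has_derivative_unique)
  from fun_cong[OF this, of "axis j 1"] show ?thesis
    by (simp add: dilation_axis left_inv_field_scaleR)
qed

lemma left_inv_deriv_dilation: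
  assumes "r > 0" "f differentiable (at (dilation wt r x))"
  shows "X j (\<lambda>x. f (dilation wt r x)) x = r ^ wt j * X j f (dilation wt r x)"
proof -
  note L = bounded_linear_dilation[of wt r]
  have "((\<lambda>x. f (dilation wt r x)) has_derivative
      (\<lambda>v. frechet_derivative f (at (dilation wt r x)) (dilation wt r v))) (at x)"
    using diff_chain_at[OF bounded_linear_imp_has_derivative[OF L]
        frechet_derivative_works[THEN iffD1, OF assms(2)]] by (simp add: o_def)
  from frechet_derivative_at[OF this, symmetric] show ?thesis
    using linear_cmul[OF linear_frechet_derivative[OF assms(2)]]
    by (simp add: left_inv_deriv_def left_inv_field_dilation[OF assms(1)])
qed

text \<open>The \<open>i\<close>-th component of \<open>X\<^sub>j\<close> does not depend on the \<open>i\<close>-th coordinate: the derivative is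
  homogeneous of the negative degree \<open>- wt j\<close> under dilations, yet continuous at \<open>0\<close>. In
  particular \<open>X\<^sub>j\<close> is divergence free.\<close>

lemma left_inv_field_diagonal_derivative:
  "frechet_derivative (\<lambda>x. vf j x $ i) (at x) (axis i 1) = 0"
proof -
  let ?b = "\<lambda>x. vf j x $ i"
  let ?c = "\<lambda>x. frechet_derivative ?b (at x) (axis i 1)"
  have diff: "?b differentiable (at y)" for y
    by (rule smooth_onD(1)[OF smooth_left_inv_field_component UNIV_I])
  have hom: "?c x = r ^ wt j * ?c (dilation wt r x)" if "r > 0" for r
  proof -
    note L = bounded_linear_dilation[of wt r]
    have b: "r ^ wt i * ?b x = r ^ wt j * ?b (dilation wt r x)" for x
      using left_inv_field_dilation[OF that, of j x] by (simp add: vec_eq_iff)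
    have "((\<lambda>x. r ^ wt j * ?b (dilation wt r x)) has_derivative
        (\<lambda>v. r ^ wt j * frechet_derivative ?b (at (dilation wt r x)) (dilation wt r v))) (at x)"
      using has_derivative_mult_right[OF diff_chain_at[OF bounded_linear_imp_has_derivative[OF L]
        frechet_derivative_works[THEN iffD1, OF diff]]] by (simp add: o_def)
    moreover have "((\<lambda>x. r ^ wt i * ?b x) has_derivative
        (\<lambda>v. r ^ wt i * frechet_derivative ?b (at x) v)) (at x)"
      by (rule has_derivative_mult_right[OF frechet_derivative_works[THEN iffD1, OF diff]])
    ultimately have "(\<lambda>v. r ^ wt i * frechet_derivative ?b (at x) v)
       = (\<lambda>v. r ^ wt j * frechet_derivative ?b (at (dilation wt r x)) (dilation wt r v))"
      unfolding b by (intro has_derivative_unique)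
    from fun_cong[OF this, of "axis i 1"] show ?thesis
      using that linear_cmul[OF linear_frechet_derivative[OF diff]]
      by (simp add: dilation_axis)
  qed
  have "continuous_on UNIV (\<lambda>r. dilation wt r x)"
    unfolding dilation_def by (intro continuous_on_vec_lambda continuous_intros)
  then have "continuous_on UNIV (\<lambda>r. r ^ wt j * ?c (dilation wt r x))"
    using smooth_on_continuous[OF smooth_onD(3)[OF smooth_left_inv_field_component]]
    by (intro continuous_on_mult continuous_on_power continuous_on_id)
      (rule continuous_on_compose2[of UNIV ?c], auto)
  then have "isCont (\<lambda>r. r ^ wt j * ?c (dilation wt r x)) 0"
    by (simp add: continuous_on_eq_continuous_at)
  then have "((\<lambda>r. r ^ wt j * ?c (dilation wt r x)) \<longlongrightarrow> 0 ^ wt j * ?c (dilation wt 0 x)) (at_right 0)"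
    unfolding isCont_def by (simp add: filterlim_at_split)
  moreover have "\<forall>\<^sub>F r in at_right 0. r ^ wt j * ?c (dilation wt r x) = ?c x"
    unfolding eventually_at_right_field by (rule exI[of _ 1]) (metis hom zero_less_one)
  ultimately have "((\<lambda>r::real. ?c x) \<longlongrightarrow> 0 ^ wt j * ?c (dilation wt 0 x)) (at_right 0)"
    by (rule Lim_transform_eventually)
  then have "?c x = 0 ^ wt j * ?c (dilation wt 0 x)"
    by (simp add: tendsto_const_iff)
  then show ?thesis using wt[of j] by simp
qed

lemma integral_left_inv_deriv:
  assumes \<phi>: "\<phi> \<in> test_functions UNIV"
  shows "(LINT x|lborel. X j \<phi> x) = 0"
proof -
  have sm: "smooth_on UNIV \<phi>" using test_functions_smooth[OF \<phi>] .
  define g where "g i x = vf j x $ i * \<phi> x" for i x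
  have g: "g i \<in> test_functions UNIV" for i
    unfolding g_def by (rule test_functions_mult[OF \<phi> smooth_left_inv_field_component open_UNIV])
  have "X j \<phi> x = (\<Sum>i\<in>UNIV. frechet_derivative (g i) (at x) (axis i 1))" for x
  proof -
    have "frechet_derivative (g i) (at x) (axis i 1) = vf j x $ i * frechet_derivative \<phi> (at x) (axis i 1)" for i
    proof -
      have "(g i has_derivative (\<lambda>v. vf j x $ i * frechet_derivative \<phi> (at x) v
          + frechet_derivative (\<lambda>x. vf j x $ i) (at x) v * \<phi> x)) (at x)"
        unfolding g_def
        by (rule has_derivative_mult[OF smooth_onD(2)[OF smooth_left_inv_field_component]
            smooth_onD(2)[OF sm]]) auto
      from frechet_derivative_at[OF this, symmetric] show ?thesis
        by (simp add: left_inv_field_diagonal_derivative)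
    qed
    then show ?thesis using left_inv_deriv_expand[OF smooth_onD(1)[OF sm]] by simp
  qed
  then have "(LINT x|lborel. X j \<phi> x)
      = (LINT x|lborel. (\<Sum>i\<in>UNIV. frechet_derivative (g i) (at x) (axis i 1)))"
    by simp
  also have "\<dots> = (\<Sum>i\<in>UNIV. LINT x|lborel. frechet_derivative (g i) (at x) (axis i 1))"
    by (intro Bochner_Integration.integral_sum test_functions_integrable[OF test_functions_derivative[OF g]])
  also have "\<dots> = 0"
    using integral_derivative_test_function[OF g] by simp
  finally show ?thesis .
qed

lemma integration_by_parts:
  assumes \<phi>: "\<phi> \<in> test_functions U" and g: "smooth_on U g" and U: "open U"
  shows "(LINT x|lborel. g x * X j \<phi> x) = - (LINT x|lborel. X j g x * \<phi> x)"
proof -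
  obtain K where K: "smooth_on UNIV \<phi>" "compact K" "K \<subseteq> U" "\<And>x. x \<notin> K \<Longrightarrow> \<phi> x = 0"
    using \<phi> by (rule test_functionsE) (rule that)
  have "X j (\<lambda>x. g x * \<phi> x) x = g x * X j \<phi> x + X j g x * \<phi> x" for x
  proof (cases "x \<in> K")
    case True
    then show ?thesis
      using K smooth_onD(1)[OF K(1)] smooth_onD(1)[OF g] by (intro left_inv_deriv_mult) auto
  next
    case False
    then show ?thesis
      using K left_inv_deriv_eq_0_outside[OF compact_imp_closed[OF K(2)] _ False, of \<phi>]
        left_inv_deriv_eq_0_outside[OF compact_imp_closed[OF K(2)] _ False, of "\<lambda>x. g x * \<phi> x"]
      by simp
  qed
  moreover have "(LINT x|lborel. X j (\<lambda>x. g x * \<phi> x) x) = 0"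
    using integral_left_inv_deriv test_functions_mono[OF subset_UNIV] test_functions_mult[OF \<phi> g U]
    by blast
  moreover have "integrable lborel (\<lambda>x. g x * X j \<phi> x)"
    by (intro integrable_weighted_test_function[OF test_functions_left_inv_deriv[OF \<phi>]]
        smooth_on_continuous g)
  moreover have "integrable lborel (\<lambda>x. X j g x * \<phi> x)"
    by (intro integrable_weighted_test_function[OF \<phi>] smooth_on_continuous smooth_left_inv_deriv g U)
  ultimately show ?thesis by simp
qed

end

section \<open>The fundamental solution and its homogeneity\<close>

text \<open>Dilations are diagonal, hence scale Lebesgue measure by a constant factor.\<close>

lemma integral_dilation_ex:
  fixes wt :: "'n::finite \<Rightarrow> nat"
  assumes "r > 0"
  shows "\<exists>c. \<forall>f::real^'n \<Rightarrow> real. f \<in> borel_measurable borel \<longrightarrow>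
    (LINT x|lborel. f x) = c * (LINT x|lborel. f (dilation wt r x))"
proof -
  define c where "c b = dilation wt r b \<bullet> b" for b :: "real^'n"
  have c: "dilation wt r b = c b *\<^sub>R b" "c b > 0" if b: "b \<in> Basis" for b
  proof -
    obtain i where "b = axis i 1" using b by (auto simp: Basis_vec_def)
    then show "dilation wt r b = c b *\<^sub>R b" "c b > 0"
      using assms by (auto simp: c_def dilation_axis inner_axis_axis)
  qed
  note l = bounded_linear.linear[OF bounded_linear_dilation[of wt r]]
  have T: "dilation wt r x = 0 + (\<Sum>b\<in>Basis. (c b * (x \<bullet> b)) *\<^sub>R b)" for x :: "real^'n"
  proof -
    have "dilation wt r x = dilation wt r (\<Sum>b\<in>Basis. (x \<bullet> b) *\<^sub>R b)"
      by (simp add: euclidean_representation)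
    also have "\<dots> = (\<Sum>b\<in>Basis. (c b * (x \<bullet> b)) *\<^sub>R b)"
      by (simp add: linear_sum[OF l] linear_cmul[OF l] c mult.commute)
    finally show ?thesis by simp
  qed
  define J where "J = (\<Prod>b\<in>(Basis :: (real^'n) set). \<bar>c b\<bar>)"
  have J0: "J \<ge> 0" by (simp add: J_def prod_nonneg)
  have m: "dilation wt r \<in> borel_measurable borel"
    by (intro borel_measurable_continuous_onI linear_continuous_on bounded_linear_dilation)
  have eq: "lborel = density (distr lborel borel (dilation wt r)) (\<lambda>_. ennreal J)"
    unfolding J_def T[abs_def]
    using lborel_affine_euclidean[of c 0] c(2) by (auto simp: less_imp_neq[symmetric] prod_ennreal)
  have "(LINT x|lborel. f x) = J * (LINT x|lborel. f (dilation wt r x))"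
    if [measurable]: "f \<in> borel_measurable borel" for f :: "real^'n \<Rightarrow> real"
    using m J0 by (subst eq) (simp add: integral_density integral_distr)
  then show ?thesis by blast
qed

text \<open>Here \<open>Q\<close> is the number for which the fundamental solution has degree \<open>2 - Q\<close>. That dilations
  scale Lebesgue measure with the exponent \<open>Q\<close> is derived from this below.\<close>

locale hardy_setting = group_with_dilations mul wt
  for mul :: "real^'n \<Rightarrow> real^'n \<Rightarrow> real^'n" and wt :: "'n \<Rightarrow> nat" +
  fixes Q :: real and u N :: "real^'n \<Rightarrow> real"
  assumes Q: "Q \<noteq> 2"
    and fund: "fundamental_solution mul wt u"
    and norm: "homogeneous_norm wt N"
    and u_N: "\<And>x. x \<noteq> 0 \<Longrightarrow> u x = N x powr (2 - Q)"
begin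

lemma N_0 [simp]: "N 0 = 0" and N_nonneg [simp]: "N x \<ge> 0" and N_eq_0_iff [simp]: "N x = 0 \<longleftrightarrow> x = 0"
  and N_pos_iff: "N x > 0 \<longleftrightarrow> x \<noteq> 0"
  and N_dilation: "r > 0 \<Longrightarrow> N (dilation wt r x) = r * N x"
  and continuous_on_N: "continuous_on S N"
  and smooth_on_N: "smooth_on (UNIV - {0}) N"
  using norm continuous_on_subset[of UNIV N S] unfolding homogeneous_norm_def
  by (auto simp: less_le)

lemma measurable_N [measurable]: "N \<in> borel_measurable borel"
  using continuous_on_N by (rule borel_measurable_continuous_onI)

lemma smooth_on_N_powr: "smooth_on (UNIV - {0}) (\<lambda>x. N x powr c)"
  by (rule smooth_on_comp_real[OF _ _ _ smooth_on_N smooth_on_powr]) (auto simp: N_pos_iff open_delete)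

lemma left_inv_deriv_comp_N:
  assumes "x \<noteq> 0" "(g has_real_derivative g') (at (N x))"
  shows "X j (\<lambda>x. g (N x)) x = g' * X j N x"
  using assms smooth_onD(1)[OF smooth_on_N, of x] by (intro left_inv_deriv_chain) auto

lemma left_inv_deriv_N_powr:
  assumes "x \<noteq> 0"
  shows "X j (\<lambda>x. N x powr c) x = c * N x powr (c - 1) * X j N x"
  using assms by (intro left_inv_deriv_comp_N)
    (auto intro!: DERIV_powr[THEN DERIV_cong] derivative_eq_intros simp: N_pos_iff powr_diff)

lemma test_functions_hgrad:
  assumes "\<phi> \<in> test_functions U"
  shows "hgrad_sq mul wt \<phi> \<in> test_functions U"
  unfolding hgrad_sq_def[abs_def] power2_eq_square
proof (rule test_functions_sum)
  fix j
  obtain K where K: "smooth_on UNIV \<phi>" "compact K" "K \<subseteq> U" "\<And>x. x \<notin> K \<Longrightarrow> \<phi> x = 0"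
    using assms by (rule test_functionsE) (rule that)
  note o = left_inv_deriv_eq_0_outside[OF compact_imp_closed[OF K(2)] K(4)]
  show "(\<lambda>x. X j \<phi> x * X j \<phi> x) \<in> test_functions U"
    by (rule test_functionsI[OF smooth_on_mult[OF open_UNIV smooth_left_inv_deriv smooth_left_inv_deriv] K(2,3)])
      (use o K(1) in auto)
qed

lemma smooth_hgrad_N: "smooth_on (UNIV - {0}) (hgrad_sq mul wt N)"
  unfolding hgrad_sq_def[abs_def] power2_eq_square
  by (intro smooth_on_sum smooth_on_mult smooth_left_inv_deriv smooth_on_N open_delete open_UNIV)

lemma hgrad_nonneg [simp]: "hgrad_sq mul wt f x \<ge> 0"
  by (simp add: hgrad_sq_def sum_nonneg)

text \<open>Points have measure zero, so \<open>u\<close> may be replaced everywhere by the power of \<open>N\<close>.\<close>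

lemma integral_fundamental_solution:
  assumes "\<phi> \<in> test_functions UNIV"
  shows "(LINT x|lborel. N x powr (2 - Q) * sublaplacian mul wt \<phi> x) = - \<phi> 0"
proof -
  have "(\<lambda>x. \<Sum>j | wt j = 1. X j (X j \<phi>) x) \<in> test_functions UNIV"
    by (intro test_functions_sum test_functions_left_inv_deriv assms)
  from smooth_on_continuous[OF test_functions_smooth[OF this]]
  have [measurable]: "sublaplacian mul wt \<phi> \<in> borel_measurable borel"
    unfolding sublaplacian_def[abs_def] by (rule borel_measurable_continuous_onI)
  \<comment> \<open>Measurability of \<open>u\<close> is read off from this form.\<close>
  have "u = (\<lambda>x. if x = 0 then u 0 else N x powr (2 - Q))"
    using u_N by auto
  then have [measurable]: "u \<in> borel_measurable borel"
    by (rule ssubst) measurable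
  have "(LINT x|lborel. u x * (- sublaplacian mul wt \<phi> x))
      = (LINT x|lborel. N x powr (2 - Q) * (- sublaplacian mul wt \<phi> x))"
  proof (rule integral_cong_AE)
    have "AE x in lborel. x \<noteq> (0::real^'n)"
      by (rule AE_lborel_singleton)
    then show "AE x in lborel. u x * (- sublaplacian mul wt \<phi> x) = N x powr (2 - Q) * (- sublaplacian mul wt \<phi> x)"
      by eventually_elim (simp add: u_N)
  qed measurable
  moreover have "(LINT x|lborel. u x * (- sublaplacian mul wt \<phi> x)) = \<phi> 0"
    using fund assms unfolding fundamental_solution_def by blast
  ultimately have "(LINT x|lborel. N x powr (2 - Q) * (- sublaplacian mul wt \<phi> x)) = \<phi> 0"
    by (rule trans[OF sym])
  then show ?thesis by simp
qed

lemma sublaplacian_dilation: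
  assumes "r > 0" "\<phi> \<in> test_functions UNIV"
  shows "sublaplacian mul wt (\<lambda>x. \<phi> (dilation wt r x)) x = r\<^sup>2 * sublaplacian mul wt \<phi> (dilation wt r x)"
proof -
  have d: "\<phi> differentiable at x" "X j \<phi> differentiable at x" for j x
    using test_functions_smooth[OF assms(2)] smooth_left_inv_deriv[OF open_UNIV test_functions_smooth[OF assms(2)]]
    by (auto intro: smooth_onD)
  have "X j (X j (\<lambda>x. \<phi> (dilation wt r x))) x = r\<^sup>2 * X j (X j \<phi>) (dilation wt r x)" if "wt j = 1" for j
  proof -
    have "X j (\<lambda>x. \<phi> (dilation wt r x)) = (\<lambda>x. r * X j \<phi> (dilation wt r x))"
      using left_inv_deriv_dilation[OF assms(1) d(1)] that by auto
    then have "X j (X j (\<lambda>x. \<phi> (dilation wt r x))) x = r * X j (\<lambda>x. r * X j \<phi> x) (dilation wt r x)"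
      using left_inv_deriv_dilation[OF assms(1), of "\<lambda>x. r * X j \<phi> x" x j] d(2) that by simp
    also have "X j (\<lambda>x. r * X j \<phi> x) (dilation wt r x) = r * X j (X j \<phi>) (dilation wt r x)"
      by (rule left_inv_deriv_chain[OF d(2)]) (auto intro!: derivative_eq_intros)
    finally show ?thesis by (simp add: power2_eq_square)
  qed
  then show ?thesis by (simp add: sublaplacian_def sum_distrib_left)
qed

lemma test_functions_dilation:
  assumes "r > 0" "\<phi> \<in> test_functions UNIV"
  shows "(\<lambda>x. \<phi> (dilation wt r x)) \<in> test_functions UNIV"
proof -
  obtain K where K: "smooth_on UNIV \<phi>" "compact K" "\<And>x. x \<notin> K \<Longrightarrow> \<phi> x = 0"
    using assms(2) by (rule test_functionsE) (rule that)
  show ?thesis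
  proof (rule test_functionsI)
    show "compact (dilation wt (1 / r) ` K)"
      using K(2) by (intro compact_continuous_image linear_continuous_on bounded_linear_dilation)
    show "smooth_on UNIV (\<lambda>x. \<phi> (dilation wt r x))"
      by (rule smooth_on_comp_linear[OF bounded_linear_dilation open_UNIV open_UNIV _ K(1)]) simp
    show "\<phi> (dilation wt r x) = 0" if "x \<notin> dilation wt (1 / r) ` K" for x
    proof (rule K(3))
      show "dilation wt r x \<notin> K"
        using that dilation_inverse[of r wt x] assms(1) by (metis image_eqI less_irrefl)
    qed
  qed simp
qed

text \<open>The scaling factor of Lebesgue measure under a dilation must be \<open>r\<^sup>Q\<close>: if \<open>\<phi>\<close> is replaced by
  \<open>\<phi> \<circ> \<delta>\<^sub>r\<close>, then \<open>\<phi> 0\<close> does not change, whereas the sub-Laplacian contributes a factor \<open>r\<^sup>2\<close> and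
  the fundamental solution, of degree \<open>2 - Q\<close>, a factor \<open>r\<close> to the power \<open>Q - 2\<close>.\<close>

lemma integral_dilation:
  assumes r: "r > 0" and f: "f \<in> borel_measurable borel"
  shows "(LINT x|lborel. f x) = r powr Q * (LINT x|lborel. f (dilation wt r x))"
proof -
  obtain c where c: "\<And>f::real^'n \<Rightarrow> real. f \<in> borel_measurable borel \<Longrightarrow>
    (LINT x|lborel. f x) = c * (LINT x|lborel. f (dilation wt r x))"
    using integral_dilation_ex[OF r] by blast
  obtain \<phi> :: "real^'n \<Rightarrow> real" where \<phi>: "\<phi> \<in> test_functions UNIV" "\<phi> 0 \<noteq> 0"
    using test_function_at_0_exists by blast
  let ?\<psi> = "\<lambda>x. \<phi> (dilation wt r x)"
  have "(\<lambda>x. \<Sum>j | wt j = 1. X j (X j \<phi>) x) \<in> test_functions UNIV"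
    by (intro test_functions_sum test_functions_left_inv_deriv \<phi>)
  from smooth_on_continuous[OF test_functions_smooth[OF this]]
  have [measurable]: "sublaplacian mul wt \<phi> \<in> borel_measurable borel"
    unfolding sublaplacian_def[abs_def] by (rule borel_measurable_continuous_onI)
  have "- \<phi> 0 = c * (LINT x|lborel. N (dilation wt r x) powr (2 - Q) * sublaplacian mul wt \<phi> (dilation wt r x))"
    unfolding integral_fundamental_solution[OF \<phi>(1), symmetric] by (rule c) measurable
  also have "(\<lambda>x. N (dilation wt r x) powr (2 - Q) * sublaplacian mul wt \<phi> (dilation wt r x))
      = (\<lambda>x. r powr (- Q) * (N x powr (2 - Q) * sublaplacian mul wt ?\<psi> x))"
  proof
    fix x
    have "r powr (- Q) * r\<^sup>2 = r powr (2 - Q)"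
      using r by (simp flip: powr_numeral powr_add)
    then show "N (dilation wt r x) powr (2 - Q) * sublaplacian mul wt \<phi> (dilation wt r x)
        = r powr (- Q) * (N x powr (2 - Q) * sublaplacian mul wt ?\<psi> x)"
      using r by (simp add: sublaplacian_dilation[OF r \<phi>(1)] N_dilation powr_mult)
  qed
  also have "c * (LINT x|lborel. r powr (- Q) * (N x powr (2 - Q) * sublaplacian mul wt ?\<psi> x))
      = c * r powr (- Q) * - \<phi> 0"
    using integral_fundamental_solution[OF test_functions_dilation[OF r \<phi>(1)]]
      dilation_eq_0_iff[of r wt 0] r by simp
  finally have "c * r powr (- Q) = 1" using \<phi>(2) by simp
  then have "c = r powr Q" using r by (simp add: powr_minus field_simps)
  then show ?thesis using c[OF f] by simp
qed

text \<open>Test functions supported off \<open>0\<close> do not see the Dirac mass, and there one derivative can be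
  moved to the fundamental solution.\<close>

lemma weakly_harmonic:
  assumes \<eta>: "\<eta> \<in> test_functions (UNIV - {0})"
  shows "(LINT x|lborel. (\<Sum>j | wt j = 1. X j (\<lambda>x. N x powr (2 - Q)) x * X j \<eta> x)) = 0"
proof -
  let ?w = "\<lambda>x. N x powr (2 - Q)"
  have \<eta>': "\<eta> \<in> test_functions UNIV" using \<eta> test_functions_mono[OF subset_UNIV] by blast
  have "\<eta> 0 = 0" using \<eta> by (rule test_functionsE) auto
  note X\<eta> = test_functions_left_inv_deriv[OF \<eta>]
  have op: "open (UNIV - {0::real^'n})" by (simp add: open_delete)
  have i1: "integrable lborel (\<lambda>x. X j ?w x * X j \<eta> x)" for j
    by (intro integrable_weighted_test_function[OF X\<eta>] smooth_on_continuous smooth_left_inv_deriv op smooth_on_N_powr)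
  have i2: "integrable lborel (\<lambda>x. ?w x * X j (X j \<eta>) x)" for j
    by (intro integrable_weighted_test_function[OF test_functions_left_inv_deriv[OF X\<eta>]]
        smooth_on_continuous smooth_on_N_powr)
  have "(LINT x|lborel. (\<Sum>j | wt j = 1. X j ?w x * X j \<eta> x))
      = (\<Sum>j | wt j = 1. LINT x|lborel. X j ?w x * X j \<eta> x)"
    by (intro Bochner_Integration.integral_sum i1)
  also have "\<dots> = - (\<Sum>j | wt j = 1. LINT x|lborel. ?w x * X j (X j \<eta>) x)"
    using integration_by_parts[OF X\<eta> smooth_on_N_powr op] by (simp flip: sum_negf)
  also have "(\<Sum>j | wt j = 1. LINT x|lborel. ?w x * X j (X j \<eta>) x)
      = (LINT x|lborel. ?w x * sublaplacian mul wt \<eta> x)"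
    unfolding sublaplacian_def sum_distrib_left
    by (intro Bochner_Integration.integral_sum[symmetric] i2)
  finally show ?thesis
    using integral_fundamental_solution[OF \<eta>'] \<open>\<eta> 0 = 0\<close> by simp
qed

section \<open>The Hardy inequality\<close>

text \<open>Weak harmonicity of \<open>N\<^sup>2\<^sup>-\<^sup>Q\<close> is tested with \<open>N\<^sup>\<beta> \<phi>\<^sup>2\<close>, where \<open>\<beta> = Q + \<alpha> - 2\<close>. This exponent
  turns the weight \<open>N\<^sup>1\<^sup>-\<^sup>Q\<close> from the gradient of the fundamental solution into \<open>N\<close> to the power
  \<open>\<alpha> - 1\<close>, and the common factor \<open>2 - Q\<close> cancels. The outcome expresses the mixed term between
  \<open>\<nabla>N\<close> and \<open>\<nabla>\<phi>\<close> through the right-hand side of the Hardy inequality.\<close>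

lemma hardy_identity:
  assumes \<phi>: "\<phi> \<in> test_functions (UNIV - {0})"
  shows "integrable lborel (\<lambda>x. N x powr (\<alpha> - 2) * hgrad_sq mul wt N x * (\<phi> x)\<^sup>2)" (is "integrable _ ?b")
    and "integrable lborel (\<lambda>x. N x powr (\<alpha> - 1) * \<phi> x * (\<Sum>j | wt j = 1. X j N x * X j \<phi> x))" (is "integrable _ ?e")
    and "2 * (LINT x|lborel. N x powr (\<alpha> - 1) * \<phi> x * (\<Sum>j | wt j = 1. X j N x * X j \<phi> x))
       = - (Q + \<alpha> - 2) * (LINT x|lborel. N x powr (\<alpha> - 2) * hgrad_sq mul wt N x * (\<phi> x)\<^sup>2)"
proof -
  have op: "open (UNIV - {0::real^'n})" by (simp add: open_delete)
  have sm: "smooth_on UNIV \<phi>" using \<phi> by (rule test_functions_smooth)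
  have \<phi>2: "(\<lambda>x. \<phi> x * \<phi> x) \<in> test_functions (UNIV - {0})"
    by (intro test_functions_mult[OF \<phi> _ op] smooth_on_subset[OF sm]) auto
  have "integrable lborel (\<lambda>x. (N x powr (\<alpha> - 2) * hgrad_sq mul wt N x) * (\<phi> x * \<phi> x))"
    by (intro integrable_weighted_test_function[OF \<phi>2] continuous_on_mult
        smooth_on_continuous smooth_on_N_powr smooth_hgrad_N)
  then show b: "integrable lborel ?b" by (simp add: power2_eq_square mult.assoc)
  have "integrable lborel (\<lambda>x. (N x powr (\<alpha> - 1) * (\<Sum>j | wt j = 1. X j N x * X j \<phi> x)) * \<phi> x)"
    by (intro integrable_weighted_test_function[OF \<phi>] continuous_on_mult continuous_on_sum
        smooth_on_continuous smooth_on_N_powr smooth_left_inv_deriv smooth_on_N op smooth_on_subset[OF sm]) auto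
  then show e: "integrable lborel ?e" by (simp add: mult_ac)
  define \<beta> where "\<beta> = Q + \<alpha> - 2"
  define \<eta> where "\<eta> x = N x powr \<beta> * (\<phi> x * \<phi> x)" for x
  have \<eta>: "\<eta> \<in> test_functions (UNIV - {0})"
    unfolding \<eta>_def by (rule test_functions_mult[OF \<phi>2 smooth_on_N_powr op])
  have vanish: "f 0 = 0" if "f \<in> test_functions (UNIV - {0})" for f :: "real^'n \<Rightarrow> real"
    using that by (rule test_functionsE) auto
  have pointwise: "(\<Sum>j | wt j = 1. X j (\<lambda>x. N x powr (2 - Q)) x * X j \<eta> x)
      = (2 - Q) * (\<beta> * ?b x + 2 * ?e x)" for x
  proof (cases "x = 0")
    case True
    then show ?thesis
      using vanish[OF \<phi>] vanish[OF test_functions_left_inv_deriv[OF \<eta>]] by simp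
  next
    case False
    then have Nx: "N x > 0" by (simp add: N_pos_iff)
    have d: "\<phi> differentiable at x" "(\<lambda>x. N x powr \<beta>) differentiable at x"
      using smooth_onD(1)[OF sm] smooth_onD(1)[OF smooth_on_N_powr] False by auto
    have "X j (\<lambda>x. N x powr (2 - Q)) x * X j \<eta> x = (2 - Q) *
        (\<beta> * N x powr (\<alpha> - 2) * (\<phi> x)\<^sup>2 * (X j N x)\<^sup>2
         + 2 * N x powr (\<alpha> - 1) * \<phi> x * (X j N x * X j \<phi> x))" for j
    proof -
      have "X j \<eta> x = N x powr \<beta> * (2 * \<phi> x * X j \<phi> x) + \<beta> * N x powr (\<beta> - 1) * X j N x * (\<phi> x)\<^sup>2"
        unfolding \<eta>_def left_inv_deriv_mult[OF d(2) differentiable_mult[OF d(1) d(1)]]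
          left_inv_deriv_mult[OF d(1) d(1)] left_inv_deriv_N_powr[OF False]
        by (simp add: power2_eq_square algebra_simps)
      moreover have "N x powr (\<alpha> - 1) = N x powr (1 - Q) * N x powr \<beta>"
        "N x powr (\<alpha> - 2) = N x powr (1 - Q) * N x powr (\<beta> - 1)"
        by (simp_all add: \<beta>_def flip: powr_add)
      ultimately show ?thesis
        unfolding left_inv_deriv_N_powr[OF False]
        by (simp add: power2_eq_square algebra_simps)
    qed
    from this[abs_def] show ?thesis
      unfolding hgrad_sq_def
      by (simp only: sum.distrib sum_distrib_left[symmetric] sum_distrib_right[symmetric] mult.assoc)
        (simp add: mult_ac)
  qed
  have "(2 - Q) * (\<beta> * integral\<^sup>L lborel ?b + 2 * integral\<^sup>L lborel ?e) = 0"
    using weakly_harmonic[OF \<eta>] b e unfolding pointwise by simp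
  then have "\<beta> * integral\<^sup>L lborel ?b + 2 * integral\<^sup>L lborel ?e = 0"
    using Q by simp
  then show "2 * integral\<^sup>L lborel ?e = - (Q + \<alpha> - 2) * integral\<^sup>L lborel ?b"
    unfolding \<beta>_def[symmetric] by linarith
qed

lemma integrable_weighted_hgrad:
  assumes "\<phi> \<in> test_functions (UNIV - {0})"
  shows "integrable lborel (\<lambda>x. N x powr \<alpha> * hgrad_sq mul wt \<phi> x)"
  by (intro integrable_weighted_test_function[OF test_functions_hgrad[OF assms]]
      smooth_on_continuous smooth_on_N_powr)

text \<open>At \<open>0\<close> both sides vanish by the conventions for \<open>powr\<close> and for division.\<close>

lemma weight_eq: "N x powr \<alpha> * (h / (N x)\<^sup>2) = N x powr (\<alpha> - 2) * h"
  by (cases "x = 0") (auto simp: powr_diff N_pos_iff)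

lemma hardy_inequality_iff:
  assumes \<phi>: "\<phi> \<in> test_functions (UNIV - {0})" and "C \<ge> 0"
  shows "hardy_inequality mul wt N \<alpha> C \<phi> \<longleftrightarrow>
    C * (LINT x|lborel. N x powr (\<alpha> - 2) * hgrad_sq mul wt N x * (\<phi> x)\<^sup>2)
      \<le> (LINT x|lborel. N x powr \<alpha> * hgrad_sq mul wt \<phi> x)"
  unfolding hardy_inequality_def weight_eq using assms
  by (simp add: nn_integral_eq_integral integrable_weighted_hgrad
      hardy_identity(1) integral_nonneg_AE ennreal_mult[symmetric])

text \<open>With \<open>\<gamma> = (Q + \<alpha> - 2) / 2\<close>, integrate the weighted square of \<open>\<nabla>\<phi> + \<gamma> \<phi> \<nabla>N / N\<close>. It would vanish
  for the power \<open>- \<gamma>\<close> of \<open>N\<close>, the extremal function that is not a test function. The identity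
  above evaluates the mixed term.\<close>

lemma hardy:
  assumes \<phi>: "\<phi> \<in> test_functions (UNIV - {0})"
  shows "hardy_inequality mul wt N \<alpha> (((Q + \<alpha> - 2) / 2)\<^sup>2) \<phi>"
proof -
  let ?a = "\<lambda>x. N x powr \<alpha> * hgrad_sq mul wt \<phi> x"
  let ?b = "\<lambda>x. N x powr (\<alpha> - 2) * hgrad_sq mul wt N x * (\<phi> x)\<^sup>2"
  let ?e = "\<lambda>x. N x powr (\<alpha> - 1) * \<phi> x * (\<Sum>j | wt j = 1. X j N x * X j \<phi> x)"
  define \<gamma> where "\<gamma> = (Q + \<alpha> - 2) / 2"
  have "0 \<le> ?a x + 2 * \<gamma> * ?e x + \<gamma>\<^sup>2 * ?b x" for x
  proof (cases "x = 0")
    case False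
    define s where "s = 1 / N x"
    have s: "N x powr (\<alpha> - 1) = N x powr \<alpha> * s" "N x powr (\<alpha> - 2) = N x powr \<alpha> * s\<^sup>2"
      using False by (simp_all add: N_pos_iff s_def powr_diff power_one_over)
    have "0 \<le> (\<Sum>j | wt j = 1. N x powr \<alpha> * (X j \<phi> x + \<gamma> * \<phi> x * X j N x * s)\<^sup>2)"
      by (intro mult_nonneg_nonneg sum_nonneg) auto
    also have "\<dots> = (\<Sum>j | wt j = 1. N x powr \<alpha> * (X j \<phi> x)\<^sup>2
        + 2 * \<gamma> * (N x powr (\<alpha> - 1) * \<phi> x * (X j N x * X j \<phi> x))
        + \<gamma>\<^sup>2 * (N x powr (\<alpha> - 2) * (X j N x)\<^sup>2 * (\<phi> x)\<^sup>2))"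
      unfolding s by (simp add: power2_eq_square algebra_simps)
    also have "\<dots> = ?a x + 2 * \<gamma> * ?e x + \<gamma>\<^sup>2 * ?b x"
      by (simp add: hgrad_sq_def sum.distrib sum_distrib_left sum_distrib_right mult_ac)
    finally show ?thesis .
  qed simp
  then have "0 \<le> (LINT x|lborel. ?a x + 2 * \<gamma> * ?e x + \<gamma>\<^sup>2 * ?b x)"
    by (intro integral_nonneg_AE) auto
  also have "\<dots> = integral\<^sup>L lborel ?a + 2 * \<gamma> * integral\<^sup>L lborel ?e + \<gamma>\<^sup>2 * integral\<^sup>L lborel ?b"
    using integrable_weighted_hgrad[OF \<phi>] hardy_identity(1,2)[OF \<phi>] by simp
  also have "2 * \<gamma> * integral\<^sup>L lborel ?e = \<gamma> * (2 * integral\<^sup>L lborel ?e)" by simp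
  also have "\<dots> = - 2 * \<gamma>\<^sup>2 * integral\<^sup>L lborel ?b"
  proof -
    have "Q + \<alpha> - 2 = 2 * \<gamma>" by (simp add: \<gamma>_def)
    then show ?thesis unfolding hardy_identity(3)[OF \<phi>] by (simp add: power2_eq_square)
  qed
  finally show ?thesis
    by (subst hardy_inequality_iff[OF \<phi>]) (simp_all add: \<gamma>_def)
qed

end

section \<open>Sharpness of the constant\<close>

context hardy_setting
begin

text \<open>Along the one-parameter group generated by a first-layer coordinate vector, dilation is
  multiplication by a scalar, and \<open>N\<close> is linear on the positive half.\<close>

lemma left_inv_deriv_N_axis:
  assumes "wt j = 1"
  shows "X j N (axis j 1) = N (axis j 1)"
proof -
  let ?e = "axis j 1 :: real^'n"
  \<comment> \<open>The curve below is the orbit of \<open>?e\<close> under right multiplication by its own one-parameter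
    group. It is differentiated in two ways.\<close>
  have scale: "N ((1 + t) *\<^sub>R ?e) = (1 + t) * N ?e" if "\<bar>t\<bar> < 1" for t
    using N_dilation[of "1 + t" ?e] that assms by (simp add: dilation_axis)
  have mulN: "mul ?e (t *\<^sub>R ?e) = (1 + t) *\<^sub>R ?e" for t
  proof -
    have "mul (1 *\<^sub>R ?e) (t *\<^sub>R ?e) = (1 + t) *\<^sub>R ?e"
      using group unfolding exponential_lie_group_def by blast
    then show ?thesis by simp
  qed
  have e: "?e \<noteq> 0" by (simp add: axis_eq_0_iff)
  have "((\<lambda>t::real. mul ?e (t *\<^sub>R ?e)) has_derivative (\<lambda>s. s *\<^sub>R vf j ?e)) (at 0)"
  proof -
    have "((\<lambda>t::real. t *\<^sub>R ?e) has_derivative (\<lambda>s. s *\<^sub>R ?e)) (at 0)"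
      by (auto intro!: derivative_eq_intros)
    from diff_chain_at[OF this, of "mul ?e" "\<lambda>v. left_inv_field mul v ?e"] has_derivative_left_inv_field[of ?e]
    show ?thesis by (simp add: o_def left_inv_field_scaleR)
  qed
  moreover have "(N has_derivative frechet_derivative N (at ?e)) (at (mul ?e (0 *\<^sub>R ?e)))"
    using smooth_onD(2)[OF smooth_on_N, of ?e] e by simp
  ultimately have "((\<lambda>t. N (mul ?e (t *\<^sub>R ?e))) has_derivative
      (\<lambda>s. frechet_derivative N (at ?e) (s *\<^sub>R vf j ?e))) (at 0)"
    using diff_chain_at by (fastforce simp: o_def)
  then have "((\<lambda>t. (1 + t) * N ?e) has_derivative
      (\<lambda>s. frechet_derivative N (at ?e) (s *\<^sub>R vf j ?e))) (at 0)"
    by (rule has_derivative_transform_within_open[of _ _ _ _ "{-1<..<1}"])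
      (auto simp: mulN scale)
  moreover have "((\<lambda>t. (1 + t) * N ?e) has_derivative (\<lambda>s. s * N ?e)) (at 0)"
    by (auto intro!: derivative_eq_intros)
  ultimately have "(\<lambda>s. frechet_derivative N (at ?e) (s *\<^sub>R vf j ?e)) = (\<lambda>s. s * N ?e)"
    by (rule has_derivative_unique)
  from fun_cong[OF this, of 1] show ?thesis by (simp add: left_inv_deriv_def)
qed

text \<open>Without first-layer coordinates the sub-Laplacian would vanish and have no fundamental
  solution.\<close>

lemma first_layer_nonempty: "\<exists>j. wt j = 1"
proof (rule ccontr)
  assume "\<not> ?thesis"
  then have 0: "sublaplacian mul wt \<phi> x = 0" for \<phi> x
    by (simp add: sublaplacian_def)
  obtain \<phi> :: "real^'n \<Rightarrow> real" where "\<phi> \<in> test_functions UNIV" "\<phi> 0 \<noteq> 0"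
    using test_function_at_0_exists by blast
  then show False using integral_fundamental_solution[of \<phi>] 0 by simp
qed

lemma hgrad_N_dilation:
  assumes "r > 0" "x \<noteq> 0"
  shows "hgrad_sq mul wt N (dilation wt r x) = hgrad_sq mul wt N x"
proof -
  have d: "N differentiable at y" if "y \<noteq> 0" for y
    using smooth_onD(1)[OF smooth_on_N, of y] that by simp
  have "X j N (dilation wt r x) = X j N x" if "wt j = 1" for j
  proof -
    have "r * X j N (dilation wt r x) = X j (\<lambda>x. N (dilation wt r x)) x"
      using left_inv_deriv_dilation[OF assms(1) d] assms that by (simp add: dilation_eq_0_iff)
    also have "\<dots> = X j (\<lambda>x. r * N x) x"
      using N_dilation[OF assms(1)] by simp
    also have "\<dots> = r * X j N x"
      by (rule left_inv_deriv_chain[OF d]) (use assms in \<open>auto intro!: derivative_eq_intros\<close>)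
    finally show ?thesis using assms by simp
  qed
  then show ?thesis by (simp add: hgrad_sq_def)
qed

text \<open>Large points can be dilated back to the unit sphere, where \<open>N\<close> has a positive minimum; so
  the sublevel sets of \<open>N\<close> are bounded.\<close>

lemma compact_N_sublevel: "compact {x. N x \<le> t}"
proof -
  let ?S = "sphere 0 1 :: (real^'n) set"
  obtain m where m: "m > 0" "\<And>y. y \<in> ?S \<Longrightarrow> m \<le> N y"
  proof -
    obtain z where "z \<in> ?S" "\<And>y. y \<in> ?S \<Longrightarrow> N z \<le> N y"
      using continuous_attains_inf[OF compact_sphere _ continuous_on_N, of "0::real^'n" 1]
      by (auto simp: sphere_eq_empty)
    moreover from this(1) have "z \<noteq> 0" by auto
    ultimately show ?thesis using that[of "N z"] by (simp add: N_pos_iff)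
  qed
  define k where "k = Max (range wt)"
  define t' where "t' = max 1 (t / m)"
  have k: "wt i \<le> k" for i by (simp add: k_def)
  have "norm x \<le> t' ^ k" if "N x \<le> t" for x
  proof (cases "norm x \<le> 1")
    case True
    moreover have "1 \<le> t' ^ k" by (simp add: t'_def one_le_power)
    ultimately show ?thesis by linarith
  next
    case False
    have "continuous_on {0..1} (\<lambda>r. norm (dilation wt r x))"
      unfolding dilation_def by (intro continuous_intros continuous_on_vec_lambda)
    moreover have wt0: "(0::real) ^ wt i = 0" for i using wt[of i] by simp
    have "dilation wt 0 x = 0" "dilation wt 1 x = x"
      by (simp_all add: vec_eq_iff wt0)
    ultimately obtain r where r: "0 \<le> r" "r \<le> 1" "norm (dilation wt r x) = 1"
      using IVT'[of "\<lambda>r. norm (dilation wt r x)" 0 1 1] False by auto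
    then have r0: "r > 0" using \<open>dilation wt 0 x = 0\<close> by (cases "r = 0") auto
    have "m \<le> r * N x" using m(2)[of "dilation wt r x"] r N_dilation[OF r0] by simp
    also have "\<dots> \<le> r * t" using that r0 by simp
    finally have "1 / r \<le> t'" using m(1) r0 by (simp add: t'_def field_simps le_max_iff_disj)
    have "norm x = norm (dilation wt (1 / r) (dilation wt r x))"
      using dilation_inverse[of r wt x] r0 by simp
    also have "\<dots> \<le> norm ((1 / r) ^ k *\<^sub>R dilation wt r x)"
    proof (rule norm_le_componentwise_cart)
      fix i
      have "(1 / r) ^ wt i \<le> (1 / r) ^ k"
        using r0 r(2) k by (intro power_increasing) auto
      then show "norm (dilation wt (1 / r) (dilation wt r x) $ i) \<le> norm (((1 / r) ^ k *\<^sub>R dilation wt r x) $ i)"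
        using r0 by (simp only: dilation_nth vector_scaleR_component real_scaleR_def real_norm_def abs_mult)
          (intro mult_right_mono, auto simp: abs_mult power_abs)
    qed
    also have "\<dots> = (1 / r) ^ k" using r0 r(3) by (simp add: power_abs)
    also have "\<dots> \<le> t' ^ k" using \<open>1 / r \<le> t'\<close> r0 by (intro power_mono) auto
    finally show ?thesis .
  qed
  then have "bounded {x. N x \<le> t}" by (auto simp: bounded_iff)
  moreover have "closed {x. N x \<le> t}"
    by (intro closed_Collect_le continuous_on_N continuous_on_const)
  ultimately show ?thesis by (simp add: compact_eq_bounded_closed)
qed

lemma compact_annulus: "compact {x. s \<le> N x \<and> N x \<le> t}"
proof -
  have "{x. s \<le> N x \<and> N x \<le> t} = {x. N x \<le> t} \<inter> {x. s \<le> N x}" by auto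
  moreover have "closed {x. s \<le> N x}"
    by (intro closed_Collect_le continuous_on_N continuous_on_const)
  ultimately show ?thesis using compact_N_sublevel compact_Int_closed by metis
qed

text \<open>This density has degree \<open>- Q\<close> under dilations, because \<open>|\<nabla>N|\<close> has degree \<open>0\<close>. The resulting
  measure is therefore invariant under dilations, and its image under \<open>ln N\<close> is invariant under
  translations.\<close>

definition W :: "real^'n \<Rightarrow> real" where
  "W x = N x powr (- Q) * hgrad_sq mul wt N x"

definition annulus_mass :: "real \<Rightarrow> real \<Rightarrow> real" where
  "annulus_mass s t = (LINT x|lborel. W x * indicator {s..<t} (N x))"

lemma W_nonneg [simp]: "W x \<ge> 0"
  by (simp add: W_def)

lemma continuous_on_W: "continuous_on (UNIV - {0}) W"
  unfolding W_def[abs_def]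
  by (intro continuous_on_mult smooth_on_continuous smooth_on_N_powr smooth_hgrad_N)

lemma measurable_W [measurable]: "W \<in> borel_measurable borel"
proof -
  have "(\<lambda>x. indicator (UNIV - {0}) x *\<^sub>R W x) \<in> borel_measurable borel"
    by (intro borel_measurable_continuous_on_indicator continuous_on_W) auto
  also have "(\<lambda>x. indicator (UNIV - {0}) x *\<^sub>R W x) = W"
    by (auto simp: indicator_def W_def)
  finally show ?thesis .
qed

lemma integrable_W_radial:
  assumes "s > 0" "g \<in> borel_measurable borel" "\<And>y. \<bar>g y\<bar> \<le> c * indicator {s..t} y"
  shows "integrable lborel (\<lambda>x. W x * g (N x))"
proof (rule Bochner_Integration.integrable_bound)
  have "continuous_on {x. s \<le> N x \<and> N x \<le> t} W"
    using assms(1) by (intro continuous_on_subset[OF continuous_on_W]) auto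
  from borel_integrable_compact[OF compact_annulus this]
  show "integrable lborel (\<lambda>x. c * (indicator {x. s \<le> N x \<and> N x \<le> t} x *\<^sub>R W x))"
    by simp
  show "AE x in lborel. norm (W x * g (N x)) \<le> norm (c * (indicator {x. s \<le> N x \<and> N x \<le> t} x *\<^sub>R W x))"
  proof (rule AE_I2)
    fix x
    have "W x * \<bar>g (N x)\<bar> \<le> W x * (c * indicator {s..t} (N x))"
      using assms(3) by (intro mult_left_mono) auto
    also have "\<dots> \<le> norm (c * (indicator {x. s \<le> N x \<and> N x \<le> t} x *\<^sub>R W x))"
      by (auto simp: indicator_def abs_mult intro: mult_left_mono)
        (metis W_nonneg abs_ge_self mult.commute mult_left_mono)
    finally show "norm (W x * g (N x)) \<le> norm (c * (indicator {x. s \<le> N x \<and> N x \<le> t} x *\<^sub>R W x))"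
      by (simp add: abs_mult)
  qed
qed (use assms(2) in measurable)

lemma annulus_integrable: "s > 0 \<Longrightarrow> integrable lborel (\<lambda>x. W x * indicator {s..<t} (N x))"
  by (rule integrable_W_radial[of s _ 1 t]) (auto simp: indicator_def)

lemma annulus_mass_scale:
  assumes "r > 0"
  shows "annulus_mass (r * s) (r * t) = annulus_mass s t"
proof -
  have "annulus_mass (r * s) (r * t)
      = r powr Q * (LINT x|lborel. W (dilation wt r x) * indicator {r * s..<r * t} (N (dilation wt r x)))"
    unfolding annulus_mass_def by (rule integral_dilation[OF assms]) measurable
  also have "(\<lambda>x. W (dilation wt r x) * indicator {r * s..<r * t} (N (dilation wt r x)))
      = (\<lambda>x. r powr (- Q) * (W x * indicator {s..<t} (N x)))"
  proof
    fix x
    have "W (dilation wt r x) = r powr (- Q) * W x"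
      using assms hgrad_N_dilation[OF assms, of x]
      by (cases "x = 0") (simp_all add: W_def N_dilation powr_mult dilation_eq_0_iff)
    then show "W (dilation wt r x) * indicator {r * s..<r * t} (N (dilation wt r x))
      = r powr (- Q) * (W x * indicator {s..<t} (N x))"
      using assms by (simp add: N_dilation indicator_def)
  qed
  finally show ?thesis
    using assms by (simp add: annulus_mass_def powr_minus field_simps)
qed

lemma annulus_mass_add:
  assumes "0 < s" "s \<le> t" "t \<le> v"
  shows "annulus_mass s v = annulus_mass s t + annulus_mass t v"
proof -
  have "W x * indicator {s..<v} (N x) = W x * indicator {s..<t} (N x) + W x * indicator {t..<v} (N x)" for x
    using assms by (auto simp: indicator_def)
  then show ?thesis
    unfolding annulus_mass_def using assms annulus_integrable by simp
qed

text \<open>In the variable \<open>ln N\<close>, both halves of \<open>{- 2 R..<2 R}\<close> are translates of \<open>{- R..<R}\<close>.\<close>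

lemma annulus_mass_double:
  assumes "R > 0"
  shows "annulus_mass (exp (- (2 * R))) (exp (2 * R)) = 2 * annulus_mass (exp (- R)) (exp R)"
proof -
  have "annulus_mass (exp (- (2 * R))) (exp (2 * R))
      = annulus_mass (exp (- (2 * R))) 1 + annulus_mass 1 (exp (2 * R))"
    using assms by (intro annulus_mass_add) auto
  also have "annulus_mass (exp (- (2 * R))) 1 = annulus_mass (exp (- R)) (exp R)"
    using annulus_mass_scale[of "exp (- R)" "exp (- R)" "exp R"] by (simp flip: exp_add)
  also have "annulus_mass 1 (exp (2 * R)) = annulus_mass (exp (- R)) (exp R)"
    using annulus_mass_scale[of "exp R" "exp (- R)" "exp R"] by (simp flip: exp_add)
  finally show ?thesis by simp
qed

text \<open>The density is positive at a coordinate vector of the first layer, and a dilation moves this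
  point into the given annulus.\<close>

lemma annulus_mass_pos:
  assumes "0 < s" "s < t"
  shows "annulus_mass s t > 0"
proof (rule ccontr)
  assume "\<not> ?thesis"
  moreover have "annulus_mass s t \<ge> 0"
    unfolding annulus_mass_def by (intro integral_nonneg_AE) auto
  ultimately have "annulus_mass s t = 0" by linarith
  then have "(LINT x|lborel. W x * indicator {s..<t} (N x)) = 0"
    by (simp add: annulus_mass_def)
  then have ae: "AE x in lborel. W x * indicator {s..<t} (N x) = 0"
    using integral_nonneg_eq_0_iff_AE[OF annulus_integrable[OF assms(1)]] by simp
  define S where "S = {x \<in> UNIV - {0}. 0 < W x} \<inter> {x. s < N x} \<inter> {x. N x < t}"
  have "open {x \<in> UNIV - {0}. 0 < W x}"
    using continuous_open_preimage[OF continuous_on_W _ open_greaterThan[of 0]]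
    by (simp add: open_delete vimage_def Collect_conj_eq[symmetric] Int_def)
  then have "open S"
    unfolding S_def by (intro open_Int open_Collect_less continuous_on_N continuous_on_const)
  obtain j where j: "wt j = 1" using first_layer_nonempty by blast
  let ?e = "axis j 1 :: real^'n"
  have e: "?e \<noteq> 0" by (simp add: axis_eq_0_iff)
  then have Ne: "N ?e > 0" by (simp add: N_pos_iff)
  obtain v where v: "s < v" "v < t" using dense assms(2) by blast
  define r where "r = v / N ?e"
  have r: "r > 0" using v assms Ne by (simp add: r_def)
  define p where "p = dilation wt r ?e"
  have "0 < (X j N ?e)\<^sup>2" using left_inv_deriv_N_axis[OF j] Ne by simp
  also have "\<dots> \<le> hgrad_sq mul wt N ?e"
    unfolding hgrad_sq_def using j by (intro member_le_sum) auto
  also have "\<dots> = hgrad_sq mul wt N p"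
    unfolding p_def by (rule hgrad_N_dilation[OF r e, symmetric])
  finally have "0 < hgrad_sq mul wt N p" .
  moreover have Np: "N p = v" using N_dilation[OF r] Ne by (simp add: p_def r_def)
  moreover from this have "p \<noteq> 0" using v assms by auto
  ultimately have "p \<in> S" using v assms by (auto simp: S_def W_def)
  then obtain d where d: "d > 0" "ball p d \<subseteq> S"
    using \<open>open S\<close> by (auto simp: open_contains_ball)
  have "S \<in> null_sets lborel"
  proof (subst AE_iff_null_sets)
    show "S \<in> sets lborel" using \<open>open S\<close> by simp
    show "AE x in lborel. x \<notin> S" using ae by eventually_elim (auto simp: S_def)
  qed
  then have "ball p d \<in> null_sets lborel"
    using null_sets_subset[of S lborel "ball p d"] d(2) by simp
  then show False
    using content_ball_pos[OF d(1), of p] by (simp add: measure_def null_sets_def)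
qed

text \<open>With \<open>\<gamma> = (Q + \<alpha> - 2) / 2\<close> this is the formal extremal function, cut off by a bump that is
  stretched to width \<open>R\<close> in the variable \<open>ln N\<close>.\<close>

definition trial :: "real \<Rightarrow> real \<Rightarrow> real^'n \<Rightarrow> real" where
  "trial \<gamma> R x = N x powr (- \<gamma>) * bump (ln (N x) / R)"

lemma bump_has_derivative: "(bump has_real_derivative deriv bump t) (at t)"
  using smooth_onD(1)[OF smooth_on_bump UNIV_I] DERIV_deriv_iff_real_differentiable by blast

lemma deriv_bump_eq_0: "\<bar>t\<bar> > 1 \<Longrightarrow> deriv bump t = 0"
proof -
  assume "\<bar>t\<bar> > 1"
  then have "frechet_derivative bump (at t) = (\<lambda>_. 0)"
    by (intro frechet_derivative_eq_0_outside[of "{-1..1}"]) (auto intro: bump_eq_0)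
  moreover have "frechet_derivative bump (at t) = (*) (deriv bump t)"
    using bump_has_derivative[of t] frechet_derivative_at unfolding has_field_derivative_def by metis
  ultimately show "deriv bump t = 0" by (metis mult.right_neutral)
qed

lemma continuous_on_deriv_bump: "continuous_on S (deriv bump)"
proof -
  have "frechet_derivative bump (at t) = (*) (deriv bump t)" for t
    using bump_has_derivative[of t] frechet_derivative_at unfolding has_field_derivative_def by metis
  then have "deriv bump = (\<lambda>t. frechet_derivative bump (at t) 1)" by simp
  then show ?thesis
    using smooth_on_continuous[OF smooth_onD(3)[OF smooth_on_bump, of 1]]
    by (auto intro: continuous_on_subset)
qed

lemma trial_test_function:
  assumes "R > 0"
  shows "trial \<gamma> R \<in> test_functions (UNIV - {0})"
proof (rule test_functions_localI)
  let ?K = "{x. exp (- R) \<le> N x \<and> N x \<le> exp R}"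
  show "open (UNIV - {0::real^'n})" by (simp add: open_delete)
  show "compact ?K" by (rule compact_annulus)
  show "?K \<subseteq> UNIV - {0}" by auto
  have op: "open (UNIV - {0::real^'n})" by (simp add: open_delete)
  have ln: "smooth_on (UNIV - {0}) (\<lambda>x. ln (N x) * (1 / R))"
    by (intro smooth_on_mult op smooth_on_const smooth_on_comp_real[OF op _ _ smooth_on_N smooth_on_ln])
      (auto simp: N_pos_iff)
  show "smooth_on (UNIV - {0}) (trial \<gamma> R)"
    unfolding trial_def[abs_def]
    using smooth_on_comp_real[OF op open_UNIV subset_UNIV ln smooth_on_bump]
    by (intro smooth_on_mult op smooth_on_N_powr) simp
  show "trial \<gamma> R x = 0" if "x \<notin> ?K" for x
  proof (cases "x = 0")
    case False
    then have Nx: "N x > 0" by (simp add: N_pos_iff)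
    have "\<bar>ln (N x)\<bar> \<ge> R"
    proof (cases "N x < exp (- R)")
      case True
      then have "ln (N x) < - R" using Nx by (metis ln_exp ln_less_cancel_iff exp_gt_zero)
      then show ?thesis by linarith
    next
      case False
      then have "exp R < N x" using that by auto
      then have "R < ln (N x)" using Nx by (metis ln_exp ln_less_cancel_iff exp_gt_zero)
      then show ?thesis by linarith
    qed
    then have "\<bar>ln (N x) / R\<bar> \<ge> 1" using assms by (simp add: field_simps)
    then show ?thesis by (simp add: trial_def bump_eq_0)
  qed (simp add: trial_def)
qed

text \<open>For \<open>\<alpha> = 2 \<gamma> - Q + 2\<close> the integrands of both sides of the Hardy inequality become functions of
  \<open>ln N / R\<close> times the invariant density. The derivative of the cut-off enters with a factor
  \<open>1 / R\<close>.\<close>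

lemma trial_weighted:
  "N x powr (2 * \<gamma> - Q) * hgrad_sq mul wt N x * (trial \<gamma> R x)\<^sup>2 = W x * (bump (ln (N x) / R))\<^sup>2"
proof (cases "x = 0")
  case False
  then have Nx: "N x > 0" by (simp add: N_pos_iff)
  have "N x powr (2 * \<gamma> - Q) * (N x powr (- \<gamma>) * N x powr (- \<gamma>)) = N x powr (- Q)"
    by (simp flip: powr_add)
  from this[symmetric] show ?thesis
    by (simp add: trial_def W_def power2_eq_square mult_ac)
qed (simp add: W_def)

lemma trial_hgrad:
  assumes "R > 0"
  shows "N x powr (2 * \<gamma> - Q + 2) * hgrad_sq mul wt (trial \<gamma> R) x
    = W x * (deriv bump (ln (N x) / R) / R - \<gamma> * bump (ln (N x) / R))\<^sup>2"
proof (cases "x = 0")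
  case False
  define y where "y = N x"
  have y: "y > 0" using False by (simp add: y_def N_pos_iff)
  let ?c = "deriv bump (ln y / R) / R - \<gamma> * bump (ln y / R)"
  have "((\<lambda>s. s powr (- \<gamma>) * bump (ln s / R)) has_real_derivative y powr (- \<gamma> - 1) * ?c) (at y)"
  proof -
    have "((\<lambda>s. ln s / R) has_real_derivative 1 / y / R) (at y)"
      using y assms by (auto intro!: derivative_eq_intros)
    note DERIV_chain2[OF bump_has_derivative this]
    moreover have "((\<lambda>s. s powr (- \<gamma>)) has_real_derivative - \<gamma> * y powr (- \<gamma> - 1)) (at y)"
      using y by (auto intro!: derivative_eq_intros simp: powr_diff)
    ultimately have "((\<lambda>s. s powr (- \<gamma>) * bump (ln s / R)) has_real_derivative
        - \<gamma> * y powr (- \<gamma> - 1) * bump (ln y / R)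
        + deriv bump (ln y / R) * (1 / y / R) * y powr (- \<gamma>)) (at y)"
      by (rule DERIV_mult[rotated])
    moreover have "- \<gamma> * y powr (- \<gamma> - 1) * bump (ln y / R)
        + deriv bump (ln y / R) * (1 / y / R) * y powr (- \<gamma>) = y powr (- \<gamma> - 1) * ?c"
      using y by (simp add: powr_diff algebra_simps)
    ultimately show ?thesis by (rule DERIV_cong)
  qed
  from left_inv_deriv_comp_N[OF False this[unfolded y_def]]
  have "X j (trial \<gamma> R) x = y powr (- \<gamma> - 1) * ?c * X j N x" for j
    by (simp add: trial_def[abs_def] y_def)
  then have "hgrad_sq mul wt (trial \<gamma> R) x = (y powr (- \<gamma> - 1))\<^sup>2 * ?c\<^sup>2 * hgrad_sq mul wt N x"
    by (simp add: hgrad_sq_def power_mult_distrib sum_distrib_left)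
  moreover have "y powr (2 * \<gamma> - Q + 2) * (y powr (- \<gamma> - 1))\<^sup>2 = y powr (- Q)"
    using y by (simp add: power2_eq_square flip: powr_add)
  ultimately have "y powr (2 * \<gamma> - Q + 2) * hgrad_sq mul wt (trial \<gamma> R) x
      = y powr (- Q) * hgrad_sq mul wt N x * ?c\<^sup>2" by algebra
  then show ?thesis by (simp add: W_def y_def)
qed (simp add: W_def)

text \<open>For the trial functions, the term with the derivative of the bump is of order \<open>R\<^sup>-\<^sup>2\<close> relative to
  the weighted square of the function itself: both are comparable to the mass of an annulus of
  logarithmic width of order \<open>R\<close>. Hence the quotient of the two sides tends to \<open>\<gamma>\<^sup>2\<close> as \<open>R\<close> grows.\<close>

lemma sharp:
  assumes \<beta>: "Q + \<alpha> - 2 > 0" and C: "C > ((Q + \<alpha> - 2) / 2)\<^sup>2"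
  shows "\<exists>\<phi> \<in> test_functions (UNIV - {0}). \<not> hardy_inequality mul wt N \<alpha> C \<phi>"
proof -
  define \<gamma> where "\<gamma> = (Q + \<alpha> - 2) / 2"
  have \<gamma>: "\<gamma> > 0" and \<alpha>: "\<alpha> = 2 * \<gamma> - Q + 2" "\<alpha> - 2 = 2 * \<gamma> - Q" and C\<gamma>: "\<gamma>\<^sup>2 < C"
    using assms by (auto simp: \<gamma>_def field_simps)
  obtain m where m: "m > 0" "\<And>t. \<bar>t\<bar> \<le> 1/2 \<Longrightarrow> m \<le> bump t"
  proof -
    have "continuous_on {-(1/2)..1/2} bump"
      using smooth_on_continuous[OF smooth_on_bump] continuous_on_subset by blast
    from continuous_attains_inf[OF compact_Icc _ this]
    obtain z where z: "z \<in> {-(1/2)..1/2}" "\<forall>t\<in>{-(1/2)..1/2}. bump z \<le> bump t" by auto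
    show ?thesis
    proof (rule that)
      show "bump z > 0" using z(1) by (intro bump_pos) auto
      show "bump z \<le> bump t" if "\<bar>t\<bar> \<le> 1/2" for t
      proof -
        have "t \<in> {-(1/2)..1/2}"
          using that unfolding atLeastAtMost_iff abs_le_iff by linarith
        then show ?thesis using z(2) by blast
      qed
    qed
  qed
  \<comment> \<open>The interval exceeds the support \<open>{-1..1}\<close>, because the annuli are half-open; by the doubling
    property this only costs a factor.\<close>
  obtain M where M: "\<And>t. \<bar>deriv bump t\<bar> \<le> M * indicator {-2..<2} t"
  proof -
    have "compact (deriv bump ` {-1..1})"
      by (intro compact_continuous_image continuous_on_deriv_bump) simp
    then obtain M where M: "\<forall>t\<in>{-1..1}. \<bar>deriv bump t\<bar> \<le> M"
      by (auto dest!: compact_imp_bounded simp: bounded_iff)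
    have "\<bar>deriv bump t\<bar> \<le> M * indicator {-2..<2} t" for t
    proof (cases "\<bar>t\<bar> \<le> 1")
      case True
      then show ?thesis using M by (auto simp: abs_le_iff)
    next
      case False
      moreover have "0 \<le> M" using M[rule_format, of 0] by simp
      ultimately show ?thesis using deriv_bump_eq_0[of t] by simp
    qed
    then show ?thesis by (rule that)
  qed
  \<comment> \<open>Half of the gap between \<open>\<gamma>\<^sup>2\<close> and \<open>C\<close> absorbs the mixed term, the other half absorbs the
    derivative of the bump once \<open>R\<close> is large.\<close>
  define \<epsilon> where "\<epsilon> = (C / \<gamma>\<^sup>2 - 1) / 2"
  have \<epsilon>: "\<epsilon> > 0" "(1 + \<epsilon>) * \<gamma>\<^sup>2 = (C + \<gamma>\<^sup>2) / 2"
    using C\<gamma> \<gamma> by (auto simp: \<epsilon>_def field_simps)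
  define D where "D = (1 + 1 / \<epsilon>) * (4 * M\<^sup>2 / m\<^sup>2)"
  have D: "D \<ge> 0" using \<epsilon> by (simp add: D_def)
  obtain n :: nat where n: "real n > D / ((C - \<gamma>\<^sup>2) / 2)"
    using reals_Archimedean2 by blast
  define R where "R = real (Suc n)"
  have R: "R \<ge> 1" by (simp add: R_def)
  have "D < (C - \<gamma>\<^sup>2) / 2 * R\<^sup>2"
  proof -
    have "D < (C - \<gamma>\<^sup>2) / 2 * real n" using n C\<gamma> by (simp add: field_simps)
    also have "\<dots> \<le> (C - \<gamma>\<^sup>2) / 2 * R\<^sup>2"
    proof (intro mult_left_mono)
      have "real n \<le> R" by (simp add: R_def)
      also have "R \<le> R\<^sup>2" using R by (simp add: power2_eq_square)
      finally show "real n \<le> R\<^sup>2" .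
    qed (use C\<gamma> in auto)
    finally show ?thesis .
  qed
  then have DR: "D / R\<^sup>2 < (C - \<gamma>\<^sup>2) / 2" using R by (simp add: field_simps)
  let ?b = "\<lambda>x. W x * (bump (ln (N x) / R))\<^sup>2"
  let ?d = "\<lambda>x. W x * (deriv bump (ln (N x) / R))\<^sup>2"
  let ?a = "\<lambda>x. W x * (deriv bump (ln (N x) / R) / R - \<gamma> * bump (ln (N x) / R))\<^sup>2"
  note \<phi> = trial_test_function[of R \<gamma>]
  have R0: "R > 0" using R by simp
  define B where "B = integral\<^sup>L lborel ?b"
  define \<nu> where "\<nu> = annulus_mass (exp (- (R / 2))) (exp (R / 2))"
  have \<nu>: "\<nu> > 0" unfolding \<nu>_def using R by (intro annulus_mass_pos) auto
  have ib: "integrable lborel ?b"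
    using hardy_identity(1)[OF \<phi>[OF R0], of \<alpha>] unfolding \<alpha>(2) trial_weighted .
  have ia: "integrable lborel ?a"
    using integrable_weighted_hgrad[OF \<phi>[OF R0], of \<alpha>] unfolding \<alpha>(1) trial_hgrad[OF R0] .
  have ind: "indicator {exp (- (c * R))..<exp (c * R)} (N x) = (indicator {- c..<c} (ln (N x) / R) :: real)"
    if "x \<noteq> 0" for x c
  proof -
    have "N x > 0" using that by (simp add: N_pos_iff)
    then have "exp (- (c * R)) \<le> N x \<longleftrightarrow> - (c * R) \<le> ln (N x)" "N x < exp (c * R) \<longleftrightarrow> ln (N x) < c * R"
      by (metis exp_le_cancel_iff exp_ln) (metis \<open>N x > 0\<close> exp_less_cancel_iff exp_ln)
    then show ?thesis using R0 by (simp add: indicator_def field_simps)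
  qed
  have W0: "W 0 = 0" by (simp add: W_def)
  have "m\<^sup>2 * \<nu> \<le> B"
  proof -
    have "m\<^sup>2 * \<nu> = (LINT x|lborel. m\<^sup>2 * (W x * indicator {exp (- (R / 2))..<exp (R / 2)} (N x)))"
      by (simp add: \<nu>_def annulus_mass_def)
    also have "\<dots> \<le> B"
      unfolding B_def
    proof (intro integral_mono ib integrable_mult_right annulus_integrable)
      fix x
      show "m\<^sup>2 * (W x * indicator {exp (- (R / 2))..<exp (R / 2)} (N x)) \<le> ?b x"
      proof (cases "x = 0 \<or> \<not> \<bar>ln (N x) / R\<bar> \<le> 1/2")
        case True
        moreover have "\<bar>y\<bar> \<le> 1/2" if "y \<in> {-(1/2)..<1/2}" for y :: real
          using that unfolding atLeastLessThan_iff abs_le_iff by linarith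
        ultimately have "x = 0 \<or> ln (N x) / R \<notin> {-(1/2)..<1/2}" by blast
        then have "W x * indicator {exp (- (R / 2))..<exp (R / 2)} (N x) = 0"
          using ind[of x "1/2"] W0 by (cases "x = 0") auto
        then show ?thesis
          by (simp only: mult_zero_right) (intro mult_nonneg_nonneg zero_le_power2 W_nonneg)
      next
        case False
        then have "m\<^sup>2 \<le> (bump (ln (N x) / R))\<^sup>2" using m by (intro power_mono) auto
        then have "W x * m\<^sup>2 \<le> ?b x" by (intro mult_left_mono) auto
        then show ?thesis by (auto simp: indicator_def mult.commute)
      qed
    qed simp
    finally show ?thesis .
  qed
  moreover have "0 < m\<^sup>2 * \<nu>" using m(1) \<nu> by simp
  ultimately have B: "B > 0" and \<nu>B: "\<nu> \<le> B / m\<^sup>2"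
    using m(1) by (linarith, simp add: pos_le_divide_eq mult.commute)
  have d_le: "?d x \<le> M\<^sup>2 * (W x * indicator {exp (- (2 * R))..<exp (2 * R)} (N x))" for x
  proof (cases "x = 0")
    case False
    let ?i = "indicator {-2..<2} (ln (N x) / R) :: real"
    have "\<bar>deriv bump (ln (N x) / R)\<bar>\<^sup>2 \<le> (M * ?i)\<^sup>2"
      by (intro power_mono M) simp
    also have "\<dots> = M\<^sup>2 * ?i"
      by (simp add: indicator_def)
    finally have "?d x \<le> W x * (M\<^sup>2 * ?i)"
      by (intro mult_left_mono) simp_all
    then show ?thesis using ind[OF False, of 2] by (simp only: mult.left_commute)
  qed (simp add: W0)
  have a_le: "?a x \<le> (1 + \<epsilon>) * \<gamma>\<^sup>2 * ?b x
     + (1 + 1 / \<epsilon>) / R\<^sup>2 * (M\<^sup>2 * (W x * indicator {exp (- (2 * R))..<exp (2 * R)} (N x)))" for x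
  proof -
    define p where "p = deriv bump (ln (N x) / R) / R"
    define q where "q = \<gamma> * bump (ln (N x) / R)"
    have "0 \<le> (p + \<epsilon> * q)\<^sup>2 / \<epsilon>" using \<epsilon> by simp
    also have "\<dots> = p\<^sup>2 / \<epsilon> + 2 * p * q + \<epsilon> * q\<^sup>2"
      using \<epsilon> by (simp add: field_simps power2_eq_square)
    finally have "(p - q)\<^sup>2 \<le> (1 + \<epsilon>) * q\<^sup>2 + (1 + 1 / \<epsilon>) * p\<^sup>2"
      by (simp add: power2_diff algebra_simps)
    then have "W x * (p - q)\<^sup>2 \<le> W x * ((1 + \<epsilon>) * q\<^sup>2 + (1 + 1 / \<epsilon>) * p\<^sup>2)"
      by (intro mult_left_mono) auto
    also have "\<dots> = (1 + \<epsilon>) * \<gamma>\<^sup>2 * ?b x + (1 + 1 / \<epsilon>) / R\<^sup>2 * ?d x"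
      by (simp add: p_def q_def power_mult_distrib power_divide algebra_simps)
    also have "\<dots> \<le> (1 + \<epsilon>) * \<gamma>\<^sup>2 * ?b x
     + (1 + 1 / \<epsilon>) / R\<^sup>2 * (M\<^sup>2 * (W x * indicator {exp (- (2 * R))..<exp (2 * R)} (N x)))"
      using \<epsilon> by (intro add_left_mono mult_left_mono d_le) auto
    finally show ?thesis by (simp add: p_def q_def)
  qed
  have "integral\<^sup>L lborel ?a \<le> (LINT x|lborel. (1 + \<epsilon>) * \<gamma>\<^sup>2 * ?b x
     + (1 + 1 / \<epsilon>) / R\<^sup>2 * (M\<^sup>2 * (W x * indicator {exp (- (2 * R))..<exp (2 * R)} (N x))))"
    by (intro integral_mono[OF ia _ a_le] Bochner_Integration.integrable_add integrable_mult_right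
        ib annulus_integrable) simp
  also have "\<dots> = (1 + \<epsilon>) * \<gamma>\<^sup>2 * B
     + (1 + 1 / \<epsilon>) / R\<^sup>2 * (M\<^sup>2 * annulus_mass (exp (- (2 * R))) (exp (2 * R)))"
    using ib annulus_integrable[of "exp (- (2 * R))"] by (simp add: B_def annulus_mass_def)
  also have "annulus_mass (exp (- (2 * R))) (exp (2 * R)) = 4 * \<nu>"
    using annulus_mass_double[of R] annulus_mass_double[of "R / 2"] R by (simp add: \<nu>_def)
  also have "(1 + \<epsilon>) * \<gamma>\<^sup>2 * B + (1 + 1 / \<epsilon>) / R\<^sup>2 * (M\<^sup>2 * (4 * \<nu>))
      \<le> (1 + \<epsilon>) * \<gamma>\<^sup>2 * B + (1 + 1 / \<epsilon>) / R\<^sup>2 * (M\<^sup>2 * (4 * (B / m\<^sup>2)))"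
    using \<epsilon> \<nu>B by (intro add_left_mono mult_left_mono) auto
  also have "\<dots> = ((C + \<gamma>\<^sup>2) / 2 + D / R\<^sup>2) * B"
    unfolding \<epsilon>(2) by (simp add: D_def distrib_right distrib_left add_divide_distrib mult_ac)
  also have "\<dots> < C * B"
    using DR B by (intro mult_strict_right_mono) (auto simp: field_simps)
  finally have "\<not> C * B \<le> integral\<^sup>L lborel ?a" by simp
  moreover have "0 \<le> C" using C\<gamma> by (smt (verit) zero_le_power2)
  ultimately have "\<not> hardy_inequality mul wt N \<alpha> C (trial \<gamma> R)"
    unfolding B_def hardy_inequality_iff[OF \<phi>[OF R0] \<open>0 \<le> C\<close>]
    unfolding \<alpha>(2) trial_weighted unfolding \<alpha>(1) trial_hgrad[OF R0] by blast
  then show ?thesis using \<phi>[OF R0] by blast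
qed

end

theorem theorem4p1:
  fixes mul :: "real^'n \<Rightarrow> real^'n \<Rightarrow> real^'n"
    and V :: "nat \<Rightarrow> (real^'n) set" and k :: nat and wt :: "'n \<Rightarrow> nat"
    and Q :: nat and u N :: "real^'n \<Rightarrow> real" and \<alpha> :: real
  assumes carnot: "carnot_group mul V k wt"
    and Q: "Q = homogeneous_dimension V k" "Q \<ge> 3"
    and fund: "fundamental_solution mul wt u"
    and norm: "homogeneous_norm wt N"
    and u_N: "\<And>x. x \<noteq> 0 \<Longrightarrow> u x = N x powr (2 - real Q)"
    and alpha: "real Q + \<alpha> - 2 > 0"
  shows "(\<forall>\<phi>\<in>test_functions (UNIV - {0}).
            hardy_inequality mul wt N \<alpha> (((real Q + \<alpha> - 2) / 2)\<^sup>2) \<phi>) \<and>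
         (\<forall>C. C > ((real Q + \<alpha> - 2) / 2)\<^sup>2 \<longrightarrow>
            \<not> (\<forall>\<phi>\<in>test_functions (UNIV - {0}). hardy_inequality mul wt N \<alpha> C \<phi>))"
proof -
  interpret hardy_setting mul wt "real Q" u N
    using carnot Q(2) fund norm u_N
    by unfold_locales (auto simp: carnot_group_def)
  show ?thesis using hardy sharp[OF alpha] by blast
qed

end
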